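(* Let $P(\lambda)=\sum_{i=0}^kP_i\,\phi_i^{(r)}(\lambda)$ be an $n\times n$ regular matrix polynomial expressed in the Chebyshev basis of the $r$th kind, where $r\in\{1,2\}$, and let $\lambda_0$ be a finite eigenvalue of $P(\lambda)$. Let $0\le\epsilon\le k-1$ be an integer and let $\mathcal{C}_P^\epsilon(\lambda)=\begin{bmatrix}M_\epsilon^C(\lambda)&K_2^{(C,2)}(\lambda)^T\\ K_1^{(C,r)}(\lambda)&0\end{bmatrix}$. Then $z$ (resp. $w$) is a right (resp. left) eigenvector of $\mathcal{C}_P^\epsilon(\lambda)$ associated with $\lambda_0$ if and only if $z=H_C^\epsilon(\lambda_0)x$ (resp. $w=G_C^\epsilon(\lambda_0)^Ty$), where $x$ (resp. $y$) is a right (resp. left) eigenvector of $P(\lambda)$ with eigenvalue $\lambda_0$.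
   Context: Chebyshev setting (here $m=n$), $k\ge2$. $\phi_j^{(1)}$ and $\phi_j^{(2)}$ are the Chebyshev polynomials of the first and second kind: both satisfy $\phi_j(\lambda)=2\lambda\phi_{j-1}(\lambda)-\phi_{j-2}(\lambda)$ for $j\ge2$, with $\phi_0^{(1)}=\phi_0^{(2)}=1$, $\phi_1^{(1)}=\lambda$, $\phi_1^{(2)}=2\lambda$. For $0\le\epsilon\le k-1$ and $i,j\in\{1,2\}$, $K_1^{(C,i)}(\lambda)$ is the $\epsilon\times(\epsilon+1)$ block matrix with blocks of size $n\times n$ $$\begin{bmatrix}I&-2\lambda I&I\\&\ddots&\ddots&\ddots\\&&I&-2\lambda I&I\\&&&I&-\phi_1^{(i)}(\lambda)I\end{bmatrix},$$ and $K_2^{(C,j)}(\lambda)$ is the $(k-1-\epsilon)\times(k-\epsilon)$ block matrix of the same form with last entry $-\phi_1^{(j)}(\lambda)I_n$ (each block row but the last is $I,-2\lambda I,I$ starting on the diagonal; the last one is $I,-\phi_1I$). $K_1$ is empty if $\epsilon=0$, $K_2$ is empty if $\epsilon=k-1$. $M_\epsilon^C(\lambda)$ is the following $(k-\epsilon)\times(\epsilon+1)$ block pencil with $n\times n$ blocks. • If $1\le\epsilon\le k-2$: the first block column has entries $2\lambda P_k+P_{k-1}$ in row 1, $P_{k-2}-P_k$ in row 2, and $P_{k-t}$ in row $t$ for $3\le t\le k-\epsilon$; the second block column has entry $-P_{k+1-t}$ in row $t$ for $1\le t\le k-\epsilon-1$ and $P_{\epsilon-1}-P_{\epsilon+1}$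 in the last row $k-\epsilon$; the remaining block columns $3,\ldots,\epsilon+1$ are zero except in the last row, whose entries there are $P_{\epsilon-2},P_{\epsilon-3},\ldots,P_0$. • If $\epsilon=k-1$: $M_\epsilon^C=[2\lambda P_k+P_{k-1},\ P_{k-2}-P_k,\ P_{k-3},\ldots,P_1,P_0]$ (block row). • If $\epsilon=0$ and $r=1$: $M_\epsilon^C$ is $\frac12$ times the block column with blocks $2\lambda P_k+P_{k-1},\ P_{k-2}-2P_k,\ P_{k-3}-P_{k-1},\ldots,P_1-P_3,\ 2P_0-P_2$ (for $k=2$: $\frac12$ times the block column with blocks $2\lambda P_2+P_1$, $2P_0-2P_2$). • If $\epsilon=0$ and $r=2$: $M_\epsilon^C$ is the block column with blocks $2\lambda P_k+P_{k-1},\ P_{k-2}-P_k,\ P_{k-3},\ldots,P_1,P_0$. Chebyshev-Horner shifts: for $s\in\{1,2\}$, integers $e\ge0$ and $i\ge0$ with $i\le k-e$, $P_{e,s}^i(\lambda)=P_k\phi_{e+i}^{(s)}(\lambda)+P_{k-1}\phi_{e+i-1}^{(s)}(\lambda)+\cdots+P_{k-i+1}\phi_{e+1}^{(s)}(\lambda)+P_{k-i}\phi_e^{(s)}(\lambda)$, where $P_0,\ldots,P_k$ are always the coefficients of $P$ in the given ($r$th kind) basis, even when $s\ne r$. Let $D_1^{(C,r)}(\lambda)$ be the block column with blocks $\phi_\epsilon^{(r)}I_n,\ldots,\phi_1^{(r)}I_n,\phi_0^{(r)}I_n$, and $D_2^{(C,2)}(\lambda)$ the block column with blocks $\phi_{k-1-\epsilon}^{(2)}I_n,\ldots,\phi_1^{(2)}I_n,\phi_0^{(2)}I_n$.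 Define the block column $H_C^\epsilon(\lambda)$ and the block row $G_C^\epsilon(\lambda)$ as follows. • $0<\epsilon<k-1$: $H_C^\epsilon$ stacks $D_1^{(C,r)}$ on top of $-P_{\epsilon,r}^1,-P_{\epsilon,r}^2,\ldots,-P_{\epsilon,r}^{k-\epsilon-1}$; $G_C^\epsilon=[(D_2^{(C,2)})^T,-P_{0,2}^{k-\epsilon},-P_{0,2}^{k-\epsilon+1},\ldots,-P_{0,2}^{k-1}]$. • $\epsilon=0$, $r=1$: $H_C^\epsilon$ has blocks $I_n,\ -P_{0,1}^1+\frac{P_{k-1}}2,\ -P_{0,1}^2+\frac{P_{k-2}}2,\ldots,-P_{0,1}^{k-1}+\frac{P_1}2$; $G_C^\epsilon=(D_2^{(C,2)})^T$. • $\epsilon=0$, $r=2$: $H_C^\epsilon$ has blocks $I_n,-P_{0,2}^1,-P_{0,2}^2,\ldots,-P_{0,2}^{k-1}$; $G_C^\epsilon=(D_2^{(C,2)})^T$. • $\epsilon=k-1$: $H_C^\epsilon=D_1^{(C,r)}$; $G_C^\epsilon=[I_n,-P_{0,2}^1,-P_{0,2}^2,\ldots,-P_{0,2}^{k-1}]$. A square matrix polynomial is regular if its determinant is not identically zero. $\lambda_0\in\mathbb{C}$ is a finite eigenvalue of $P$ if $P(\lambda_0)$ is singular; a right (left) eigenvector is a nonzero $x$ with $P(\lambda_0)x=0$ (nonzero $y$ with $y^TP(\lambda_0)=0$, plain transpose); the same for pencils. *)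

theory Defs
  imports Complex_Main "Jordan_Normal_Form.Determinant"
begin

section \<open>Matrix polynomials, eigenvalues and eigenvectors\<close>

text \<open>A matrix polynomial (in particular a pencil) is a matrix with entries in \<open>complex poly\<close>.\<close>

definition eval_mat :: "complex poly mat \<Rightarrow> complex \<Rightarrow> complex mat" where
  "eval_mat A c = map_mat (\<lambda>p. poly p c) A"

text \<open>The determinant below is the one of the polynomial matrix, an element of \<open>complex poly\<close>.\<close>

definition regular_mat_poly :: "complex poly mat \<Rightarrow> bool" where
  "regular_mat_poly A \<longleftrightarrow> square_mat A \<and> det A \<noteq> 0"

definition finite_eigenvalue :: "complex poly mat \<Rightarrow> complex \<Rightarrow> bool" where
  "finite_eigenvalue A c \<longleftrightarrow> \<not> invertible_mat (eval_mat A c)"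

definition right_eigenvector :: "complex poly mat \<Rightarrow> complex \<Rightarrow> complex vec \<Rightarrow> bool" where
  "right_eigenvector A c x \<longleftrightarrow>
     x \<in> carrier_vec (dim_col A) \<and> x \<noteq> 0\<^sub>v (dim_col A) \<and>
     eval_mat A c *\<^sub>v x = 0\<^sub>v (dim_row A)"

text \<open>\<open>mat_of_row y\<close> is the plain (unconjugated) transpose of the column \<open>y\<close>.\<close>

definition left_eigenvector :: "complex poly mat \<Rightarrow> complex \<Rightarrow> complex vec \<Rightarrow> bool" where
  "left_eigenvector A c y \<longleftrightarrow>
     y \<in> carrier_vec (dim_row A) \<and> y \<noteq> 0\<^sub>v (dim_row A) \<and>
     mat_of_row y * eval_mat A c = 0\<^sub>m 1 (dim_col A)"

section \<open>Block matrices\<close>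

text \<open>The \<open>p \<times> q\<close> block matrix whose \<open>(s, t)\<close> block, with block indices counted from 1,
  is the \<open>n \<times> n\<close> matrix \<open>B s t\<close>.\<close>

definition block_mat :: "nat \<Rightarrow> nat \<Rightarrow> nat \<Rightarrow> (nat \<Rightarrow> nat \<Rightarrow> 'a mat) \<Rightarrow> 'a mat" where
  "block_mat n p q B =
     mat (p * n) (q * n) (\<lambda>(a, b). B (a div n + 1) (b div n + 1) $$ (a mod n, b mod n))"

abbreviation block_col :: "nat \<Rightarrow> nat \<Rightarrow> (nat \<Rightarrow> 'a mat) \<Rightarrow> 'a mat" where
  "block_col n p B \<equiv> block_mat n p 1 (\<lambda>s t. B s)"

abbreviation block_row :: "nat \<Rightarrow> nat \<Rightarrow> (nat \<Rightarrow> 'a mat) \<Rightarrow> 'a mat" where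
  "block_row n q B \<equiv> block_mat n 1 q (\<lambda>s t. B t)"

definition append_cols :: "'a::zero mat \<Rightarrow> 'a mat \<Rightarrow> 'a mat" (infixr \<open>@\<^sub>c\<close> 65) where
  "A @\<^sub>c B = four_block_mat A B (0\<^sub>m 0 (dim_col A)) (0\<^sub>m 0 (dim_col B))"

text \<open>The sum of the \<open>n \<times> n\<close> matrices \<open>F i\<close>, \<open>i \<in> I\<close>. (Matrices of varying size do not form
  an instance of class \<open>comm_monoid_add\<close>, so \<open>sum\<close> is not available.)\<close>

definition mat_sum :: "nat \<Rightarrow> (nat \<Rightarrow> 'a::comm_monoid_add mat) \<Rightarrow> nat set \<Rightarrow> 'a mat" where
  "mat_sum n F I = mat n n (\<lambda>ab. \<Sum>i\<in>I. F i $$ ab)"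

section \<open>Chebyshev polynomials and matrix polynomials in the Chebyshev basis\<close>

text \<open>\<open>cheb s j\<close> is the \<open>j\<close>-th Chebyshev polynomial of the \<open>s\<close>-th kind, \<open>s \<in> {1, 2}\<close>.\<close>

fun cheb :: "nat \<Rightarrow> nat \<Rightarrow> complex poly" where
  "cheb s 0 = 1"
| "cheb s (Suc 0) = (if s = 1 then [:0, 1:] else [:0, 2:])"
| "cheb s (Suc (Suc j)) = [:0, 2:] * cheb s (Suc j) - cheb s j"

abbreviation const_mat :: "complex mat \<Rightarrow> complex poly mat" where
  "const_mat A \<equiv> map_mat (\<lambda>a. [:a:]) A"

definition cheb_mat_poly :: "nat \<Rightarrow> nat \<Rightarrow> nat \<Rightarrow> (nat \<Rightarrow> complex mat) \<Rightarrow> complex poly mat" where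
  "cheb_mat_poly r n k P = mat_sum n (\<lambda>i. cheb r i \<cdot>\<^sub>m const_mat (P i)) {0..k}"

text \<open>The Chebyshev-Horner shift \<open>P\<^sub>e\<^sub>,\<^sub>s\<^sup>i\<close>, for \<open>i \<le> k - e\<close>.\<close>

definition cheb_horner ::
  "nat \<Rightarrow> nat \<Rightarrow> (nat \<Rightarrow> complex mat) \<Rightarrow> nat \<Rightarrow> nat \<Rightarrow> nat \<Rightarrow> complex poly mat" where
  "cheb_horner n k P e s i = mat_sum n (\<lambda>l. cheb s (e + l) \<cdot>\<^sub>m const_mat (P (k - i + l))) {0..i}"

section \<open>The pencil\<close>

text \<open>The \<open>m \<times> (m + 1)\<close> block matrix with block rows \<open>I, -2\<lambda>I, I\<close> starting on the diagonal,
  except for the last one, which is \<open>I, -\<phi>\<^sub>1\<^sup>(\<^sup>s\<^sup>)I\<close>.\<close>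

definition K_cheb :: "nat \<Rightarrow> nat \<Rightarrow> nat \<Rightarrow> complex poly mat" where
  "K_cheb n m s = block_mat n m (m + 1) (\<lambda>i j.
     if j = i then 1\<^sub>m n
     else if j = i + 1 then (if i = m then - (cheb s 1 \<cdot>\<^sub>m 1\<^sub>m n) else - ([:0, 2:] \<cdot>\<^sub>m 1\<^sub>m n))
     else if j = i + 2 then 1\<^sub>m n
     else 0\<^sub>m n n)"

definition M_cheb ::
  "nat \<Rightarrow> nat \<Rightarrow> nat \<Rightarrow> nat \<Rightarrow> (nat \<Rightarrow> complex mat) \<Rightarrow> complex poly mat" where
  "M_cheb r n k \<epsilon> P =
    (let Q = (\<lambda>i. const_mat (P i));
         top = [:0, 2:] \<cdot>\<^sub>m Q k + Q (k - 1);
         lead = (\<lambda>t. if t = 1 then top else if t = 2 then Q (k - 2) - Q k else Q (k - t))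
     in
      if \<epsilon> = k - 1 then block_row n k lead
      else if 0 < \<epsilon> then
        block_mat n (k - \<epsilon>) (\<epsilon> + 1) (\<lambda>t s.
          if s = 1 then lead t
          else if s = 2 then
            (if t < k - \<epsilon> then - Q (k + 1 - t) else Q (\<epsilon> - 1) - Q (\<epsilon> + 1))
          else if t = k - \<epsilon> then Q (\<epsilon> + 1 - s)
          else 0\<^sub>m n n)
      else if r = 1 then
        [:1 / 2:] \<cdot>\<^sub>m block_col n k (\<lambda>t.
          if t = 1 then top
          else if k = 2 then [:2:] \<cdot>\<^sub>m Q 0 - [:2:] \<cdot>\<^sub>m Q 2
          else if t = 2 then Q (k - 2) - [:2:] \<cdot>\<^sub>m Q k
          else if t = k then [:2:] \<cdot>\<^sub>m Q 0 - Q 2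
          else Q (k - t) - Q (k - t + 2))
      else block_col n k lead)"

definition C_cheb ::
  "nat \<Rightarrow> nat \<Rightarrow> nat \<Rightarrow> nat \<Rightarrow> (nat \<Rightarrow> complex mat) \<Rightarrow> complex poly mat" where
  "C_cheb r n k \<epsilon> P =
     four_block_mat (M_cheb r n k \<epsilon> P) (transpose_mat (K_cheb n (k - 1 - \<epsilon>) 2))
                    (K_cheb n \<epsilon> r) (0\<^sub>m (\<epsilon> * n) ((k - 1 - \<epsilon>) * n))"

section \<open>The block column H and the block row G\<close>

text \<open>The block column \<open>\<phi>\<^sub>m\<^sup>(\<^sup>s\<^sup>)I, \<dots>, \<phi>\<^sub>1\<^sup>(\<^sup>s\<^sup>)I, \<phi>\<^sub>0\<^sup>(\<^sup>s\<^sup>)I\<close>.\<close>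

definition D_cheb :: "nat \<Rightarrow> nat \<Rightarrow> nat \<Rightarrow> complex poly mat" where
  "D_cheb n m s = block_col n (m + 1) (\<lambda>t. cheb s (m + 1 - t) \<cdot>\<^sub>m 1\<^sub>m n)"

definition H_cheb ::
  "nat \<Rightarrow> nat \<Rightarrow> nat \<Rightarrow> nat \<Rightarrow> (nat \<Rightarrow> complex mat) \<Rightarrow> complex poly mat" where
  "H_cheb r n k \<epsilon> P =
    (if \<epsilon> = k - 1 then D_cheb n \<epsilon> r
     else if 0 < \<epsilon> then
       D_cheb n \<epsilon> r @\<^sub>r block_col n (k - \<epsilon> - 1) (\<lambda>t. - cheb_horner n k P \<epsilon> r t)
     else if r = 1 then
       1\<^sub>m n @\<^sub>r block_col n (k - 1)
         (\<lambda>t. - cheb_horner n k P 0 1 t + [:1 / 2:] \<cdot>\<^sub>m const_mat (P (k - t)))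
     else
       1\<^sub>m n @\<^sub>r block_col n (k - 1) (\<lambda>t. - cheb_horner n k P 0 2 t))"

text \<open>\<open>G\<close> does not depend on the kind \<open>r\<close> of the basis.\<close>

definition G_cheb ::
  "nat \<Rightarrow> nat \<Rightarrow> nat \<Rightarrow> (nat \<Rightarrow> complex mat) \<Rightarrow> complex poly mat" where
  "G_cheb n k \<epsilon> P =
    (if \<epsilon> = k - 1 then 1\<^sub>m n @\<^sub>c block_row n (k - 1) (\<lambda>t. - cheb_horner n k P 0 2 t)
     else if 0 < \<epsilon> then
       transpose_mat (D_cheb n (k - 1 - \<epsilon>) 2)
         @\<^sub>c block_row n \<epsilon> (\<lambda>t. - cheb_horner n k P 0 2 (k - \<epsilon> - 1 + t))
     else transpose_mat (D_cheb n (k - 1) 2))"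

end

theory Submission
  imports Defs
begin

text \<open>
  Evaluated at \<open>\<lambda>\<^sub>0\<close>, the kernel of \<open>K\<^sub>1\<close> is the range of \<open>D\<^sub>1\<close>, by the three-term recurrence. Hence a null
  vector of the pencil is \<open>(D\<^sub>1 x, v)\<close> with \<open>M D\<^sub>1 x + K\<^sub>2\<^sup>T v = 0\<close>. The Chebyshev-Horner shifts satisfy
  the same recurrence up to the terms collected in \<open>M D\<^sub>1\<close>, so \<open>M D\<^sub>1 + K\<^sub>2\<^sup>T H\<^sub>2 = E P\<close>, where \<open>H\<^sub>2\<close> is the
  lower part of \<open>H\<close> and \<open>E\<close> is the inclusion of the last block. Since \<open>[K\<^sub>2\<^sup>T, E]\<close> is block
  lower unitriangular, \<open>v = H\<^sub>2 x\<close> and \<open>P x = 0\<close>. The left eigenvectors are the right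
  eigenvectors of the transposed pencil, which has the same shape with the roles of \<open>K\<^sub>1\<close> and \<open>K\<^sub>2\<close>
  exchanged. All blocks except those of \<open>M\<close>, \<open>H\<^sub>2\<close> and \<open>P\<close> are scalar, so that the identity can be
  checked for each matrix entry separately.
\<close>

section \<open>Scalar Chebyshev-Horner identities\<close>

abbreviation two_X :: "complex poly" where "two_X \<equiv> [:0, 2:]"

text \<open>These rules would unfold a product with \<open>two_X\<close> or \<open>[:1/2:]\<close>
  into shifts and scalar multiples. Without them it stays a ring product, as the identities below
  need.\<close>

declare mult_pCons_left [simp del] mult_pCons_right [simp del]

lemma half_mult_2 [simp]: "[:1/2:] * (2 * q) = (q :: complex poly)"
  by (simp add: mult_pCons_left numeral_poly)

lemma cheb_rec: "j \<ge> 2 \<Longrightarrow> cheb s j = two_X * cheb s (j - 1) - cheb s (j - 2)"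
  by (cases "(s, j)" rule: cheb.cases) auto

section \<open>Rows and columns of K applied to scalar sequences\<close>

definition K_coeff :: "nat \<Rightarrow> 'a \<Rightarrow> 'a \<Rightarrow> nat \<Rightarrow> nat \<Rightarrow> 'a::comm_ring_1" where
  "K_coeff m a b i j =
    (if j = i then 1 else if j = i + 1 then (if i = m then - b else - a)
     else if j = i + 2 then 1 else 0)"

text \<open>\<open>a\<close> and \<open>b\<close> stay abstract because the formula is needed for
  the polynomials 2\<lambda> and \<phi>_1 as well as for their values at a point. The last row has
  only two nonzero entries, hence the condition on \<open>f (i + 2)\<close>.\<close>

lemma sum_K_coeff_row:
  assumes "1 \<le> i" "i \<le> m"
  shows "(\<Sum>j = 1..m + 1. K_coeff m a b i j * f j) =
    f i - (if i = m then b else a) * f (i + 1) + (if i < m then f (i + 2) else 0)"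
proof -
  have "(\<Sum>j = 1..m + 1. K_coeff m a b i j * f j) =
     (\<Sum>j = 1..m + 1. (if j = i then f i else 0)
        - (if j = i + 1 then (if i = m then b else a) * f (i + 1) else 0)
        + (if j = i + 2 then f (i + 2) else 0))"
    by (rule sum.cong) (auto simp: K_coeff_def)
  also have "\<dots> = f i - (if i = m then b else a) * f (i + 1) + (if i < m then f (i + 2) else 0)"
    using assms by (simp add: sum.distrib sum_subtractf)
  finally show ?thesis .
qed

lemma sum_K_coeff_col:
  assumes "1 \<le> j" "j \<le> m + 1"
  shows "(\<Sum>i = 1..m. K_coeff m a b i j * f i) =
    (if j \<le> m then f j else 0)
     - (if 2 \<le> j then (if j = m + 1 then b else a) * f (j - 1) else 0)
     + (if 3 \<le> j then f (j - 2) else 0)"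
proof -
  \<comment> \<open>For j \<le> 2 the truncated \<open>j - 2\<close>, and for j = 1 also
    \<open>j - 1\<close>, is 0. This lies outside the range of \<open>i\<close>, so the
    corresponding term vanishes as it should.\<close>
  have "(\<Sum>i = 1..m. K_coeff m a b i j * f i) =
     (\<Sum>i = 1..m. (if i = j then f j else 0)
        - (if i = j - 1 then (if j = m + 1 then b else a) * f (j - 1) else 0)
        + (if i = j - 2 then f (j - 2) else 0))"
  proof (rule sum.cong [OF refl])
    fix i assume i: "i \<in> {1..m}"
    consider "j = i" | "j = i + 1" | "j = i + 2" | "j \<noteq> i" "i \<noteq> j - 1" "i \<noteq> j - 2"
      "j \<noteq> i + 1" "j \<noteq> i + 2"
      using assms i by fastforce
    then show "K_coeff m a b i j * f i = (if i = j then f j else 0)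
        - (if i = j - 1 then (if j = m + 1 then b else a) * f (j - 1) else 0)
        + (if i = j - 2 then f (j - 2) else 0)"
    proof cases
      case 1
      then have "i \<noteq> j - 1" "i \<noteq> j - 2" using i by auto
      with 1 show ?thesis by (simp add: K_coeff_def)
    next
      case 2
      then have "i \<noteq> j - 2" using i by auto
      with 2 show ?thesis by (simp add: K_coeff_def)
    qed (simp_all add: K_coeff_def)
  qed
  also have "\<dots> = (if j \<le> m then f j else 0)
     - (if 2 \<le> j then (if j = m + 1 then b else a) * f (j - 1) else 0)
     + (if 3 \<le> j then f (j - 2) else 0)"
    using assms by (auto simp add: sum.distrib sum_subtractf)
  finally show ?thesis .
qed

section \<open>Chebyshev-Horner shifts of a scalar expansion\<close>

definition horner :: "nat \<Rightarrow> nat \<Rightarrow> (nat \<Rightarrow> complex poly) \<Rightarrow> nat \<Rightarrow> nat \<Rightarrow> complex poly" where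
  "horner k s p e i = (\<Sum>l = 0..i. cheb s (e + l) * p (k - i + l))"

lemma horner_0 [simp]: "horner k s p e 0 = cheb s e * p k"
  by (simp add: horner_def)

lemma horner_1: "1 \<le> k \<Longrightarrow> horner k s p e 1 = cheb s e * p (k - 1) + cheb s (e + 1) * p k"
  by (simp add: horner_def)

text \<open>The terms with \<open>l\<close> at least 2 inherit the three-term recurrence; the two
  lowest terms give the correction. Its last factor is -\<phi>_{e-1} for e \<ge> 1. For e = 0 it is
  0 for the second kind but -\<lambda> for the first kind, which is why \<epsilon> = 0, r = 1 is a
  case of its own.\<close>

lemma horner_rec:
  assumes "2 \<le> i" "i \<le> k"
  shows "horner k s p e i = two_X * horner k s p e (i - 1) - horner k s p e (i - 2)
    + cheb s e * p (k - i) + (cheb s (e + 1) - two_X * cheb s e) * p (k + 1 - i)"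
proof -
  obtain j where i: "i = Suc (Suc j)"
    using assms by (metis add_2_eq_Suc le_Suc_ex)
  have j: "k + 1 - i = k - Suc j" "Suc (k - i) = k - Suc j" "Suc (k - Suc j) = k - j"
    using assms i by auto
  have 1: "horner k s p e (Suc j) =
      cheb s e * p (k - Suc j) + (\<Sum>l = 0..j. cheb s (Suc (e + l)) * p (k - j + l))"
    unfolding horner_def using assms i
    by (simp add: sum.atLeast0_atMost_Suc_shift Suc_diff_Suc del: sum.cl_ivl_Suc cheb.simps)
  have "horner k s p e i = cheb s e * p (k - i) + cheb s (Suc e) * p (k - Suc j)
      + (\<Sum>l = 0..j. cheb s (Suc (Suc (e + l))) * p (k - j + l))"
    unfolding horner_def i using assms i
    by (simp add: sum.atLeast0_atMost_Suc_shift Suc_diff_Suc add.assoc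
          del: sum.cl_ivl_Suc cheb.simps)
  also have "(\<Sum>l = 0..j. cheb s (Suc (Suc (e + l))) * p (k - j + l)) =
      two_X * (\<Sum>l = 0..j. cheb s (Suc (e + l)) * p (k - j + l)) - horner k s p e j"
    unfolding horner_def sum_distrib_left sum_subtractf [symmetric]
    by (rule sum.cong) (simp_all add: algebra_simps)
  finally show ?thesis
    unfolding i using 1 j(1) [unfolded i] by (simp add: algebra_simps)
qed

text \<open>The longest shift accounts for the part of P of index at least \<open>e\<close>; the
  part below \<open>e\<close> is what the last block row of M contributes.\<close>

lemma sum_split_horner:
  assumes "e \<le> k"
  shows "(\<Sum>i = 0..k. cheb s i * p i) = horner k s p e (k - e) + (\<Sum>i<e. cheb s i * p i)"
proof -
  have "{0..k} = {e..k} \<union> {..<e}" using assms by auto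
  then have "(\<Sum>i = 0..k. cheb s i * p i) =
      (\<Sum>i = e..k. cheb s i * p i) + (\<Sum>i<e. cheb s i * p i)"
    by (simp only:) (rule sum.union_disjoint, auto)
  also have "(\<Sum>i = e..k. cheb s i * p i) = horner k s p e (k - e)"
    unfolding horner_def
    by (rule sum.reindex_bij_witness [where i = "\<lambda>l. e + l" and j = "\<lambda>i. i - e"])
       (use assms in auto)
  finally show ?thesis .
qed

section \<open>Right identity: M applied to \<open>D_1\<close>, completed by the shifts in H\<close>

definition lead_coeffs :: "nat \<Rightarrow> (nat \<Rightarrow> complex poly) \<Rightarrow> nat \<Rightarrow> complex poly" where
  "lead_coeffs k p t =
    (if t = 1 then two_X * p k + p (k - 1) else if t = 2 then p (k - 2) - p k else p (k - t))"

text \<open>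
  One entry of \<open>M_cheb\<close> as a function of the corresponding entries of the coefficients. The cases
  \<open>\<epsilon> = k - 1\<close> and \<open>\<epsilon> = 0\<close>, \<open>r = 2\<close> of the pencil are instances of the generic formula \<open>M_coeff\<close>;
  only \<open>\<epsilon> = 0\<close>, \<open>r = 1\<close> needs \<open>M0_coeff\<close>.
\<close>

definition M_coeff ::
  "nat \<Rightarrow> nat \<Rightarrow> (nat \<Rightarrow> complex poly) \<Rightarrow> nat \<Rightarrow> nat \<Rightarrow> complex poly" where
  "M_coeff k \<epsilon> p t s =
    (if s = 1 then lead_coeffs k p t
     else if s = 2 then (if t < k - \<epsilon> then - p (k + 1 - t) else p (\<epsilon> - 1) - p (\<epsilon> + 1))
     else if t = k - \<epsilon> then p (\<epsilon> + 1 - s) else 0)"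

definition M0_coeff :: "nat \<Rightarrow> (nat \<Rightarrow> complex poly) \<Rightarrow> nat \<Rightarrow> complex poly" where
  "M0_coeff k p t = [:1/2:] *
    (if t = 1 then two_X * p k + p (k - 1)
     else (if t = k then 2 * p 0 else p (k - t)) - (if t = 2 then 2 * p k else p (k + 2 - t)))"

lemma M_coeff_row_sum:
  assumes "2 \<le> k" "\<epsilon> \<le> k - 1" "1 \<le> t" "t \<le> k - \<epsilon>"
  shows "(\<Sum>s = 1..\<epsilon> + 1. M_coeff k \<epsilon> p t s * cheb r (\<epsilon> + 1 - s)) =
    lead_coeffs k p t * cheb r \<epsilon>
    + (if \<epsilon> = 0 then 0 else - p (k + 1 - t) * cheb r (\<epsilon> - 1))
    + (if t = k - \<epsilon> then \<Sum>i<\<epsilon>. cheb r i * p i else 0)"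
proof (cases "\<epsilon> = 0")
  case True
  then show ?thesis by (simp add: M_coeff_def)
next
  case False
  \<comment> \<open>Columns 1 and 2 have entries in every row; the later columns are nonzero only in
    the last row, where they hold the coefficients of index below \<epsilon> - 1.\<close>
  then have "{1..\<epsilon> + 1} = {1, 2} \<union> {3..\<epsilon> + 1}" by auto
  then have "(\<Sum>s = 1..\<epsilon> + 1. M_coeff k \<epsilon> p t s * cheb r (\<epsilon> + 1 - s)) =
      lead_coeffs k p t * cheb r \<epsilon> + M_coeff k \<epsilon> p t 2 * cheb r (\<epsilon> - 1)
      + (\<Sum>s = 3..\<epsilon> + 1. M_coeff k \<epsilon> p t s * cheb r (\<epsilon> + 1 - s))"
    by (simp only:) (subst sum.union_disjoint, auto simp: M_coeff_def)
  also have "(\<Sum>s = 3..\<epsilon> + 1. M_coeff k \<epsilon> p t s * cheb r (\<epsilon> + 1 - s)) =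
      (if t = k - \<epsilon> then \<Sum>i<\<epsilon> - 1. cheb r i * p i else 0)"
  proof (cases "t = k - \<epsilon>")
    case True
    then have "(\<Sum>s = 3..\<epsilon> + 1. M_coeff k \<epsilon> p t s * cheb r (\<epsilon> + 1 - s)) =
        (\<Sum>i<\<epsilon> - 1. cheb r i * p i)"
      by (intro sum.reindex_bij_witness [where i = "\<lambda>i. \<epsilon> + 1 - i" and j = "\<lambda>s. \<epsilon> + 1 - s"])
         (auto simp: M_coeff_def)
    with True show ?thesis by simp
  qed (simp add: M_coeff_def)
  also have "lead_coeffs k p t * cheb r \<epsilon> + M_coeff k \<epsilon> p t 2 * cheb r (\<epsilon> - 1)
      + (if t = k - \<epsilon> then \<Sum>i<\<epsilon> - 1. cheb r i * p i else 0) =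
    lead_coeffs k p t * cheb r \<epsilon> - p (k + 1 - t) * cheb r (\<epsilon> - 1)
    + (if t = k - \<epsilon> then \<Sum>i<\<epsilon>. cheb r i * p i else 0)"
  proof -
    have "(\<Sum>i<\<epsilon>. cheb r i * p i) = (\<Sum>i<\<epsilon> - 1. cheb r i * p i) + cheb r (\<epsilon> - 1) * p (\<epsilon> - 1)"
      using False by (metis Suc_pred' bot_nat_0.not_eq_extremum sum.lessThan_Suc)
    \<comment> \<open>So column 2 contains \<open>- p (k + 1 - t)\<close> in the last row too, and
      the summand \<open>p (\<epsilon> - 1)\<close> there completes the sum over the indices below
      \<epsilon>.\<close>
    moreover have "k + 1 - (k - \<epsilon>) = \<epsilon> + 1" using assms by auto
    ultimately show ?thesis using assms by (auto simp: M_coeff_def algebra_simps)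
  qed
  finally show ?thesis using False by simp
qed

text \<open>Row t of \<open>M D_1\<close> is the defect of the shifts in the recurrence, and
  \<open>K_2^T\<close> applied to the negated shifts cancels it. In the last row one shift is left
  over, which together with the low-index terms is P.\<close>

lemma M_coeff_right:
  assumes "2 \<le> k" "\<epsilon> \<le> k - 1" "\<epsilon> = 0 \<longrightarrow> r \<noteq> 1" "1 \<le> t" "t \<le> k - \<epsilon>"
  shows "(\<Sum>s = 1..\<epsilon> + 1. M_coeff k \<epsilon> p t s * cheb r (\<epsilon> + 1 - s))
     + (\<Sum>i = 1..k - 1 - \<epsilon>. K_coeff (k - 1 - \<epsilon>) two_X (cheb 2 1) i t * - horner k r p \<epsilon> i)
    = (if t = k - \<epsilon> then \<Sum>i = 0..k. cheb r i * p i else 0)"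
proof -
  let ?S = "horner k r p \<epsilon>"
  \<comment> \<open>For \<epsilon> = 0 this is the convention \<phi>_{-1} = 0, consistent with the
    recurrence of the second kind; for the first kind the right-hand side would be
    \<lambda>.\<close>
  have c: "(if \<epsilon> = 0 then 0 else cheb r (\<epsilon> - 1)) = two_X * cheb r \<epsilon> - cheb r (\<epsilon> + 1)"
    using assms(3) by (cases \<epsilon>) auto
  \<comment> \<open>Since \<open>cheb 2 1\<close> equals \<open>two_X\<close>, the last row of
    \<open>K_2\<close> is not exceptional. The diagonal term is absent exactly for
    \<open>t = k - \<epsilon>\<close>, which the first summand corrects.\<close>
  have K: "(\<Sum>i = 1..k - 1 - \<epsilon>. K_coeff (k - 1 - \<epsilon>) two_X (cheb 2 1) i t * - ?S i) =
    (if t = k - \<epsilon> then ?S t else 0) - ?S t + (if 2 \<le> t then two_X * ?S (t - 1) else 0)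
     - (if 3 \<le> t then ?S (t - 2) else 0)"
    using assms by (subst sum_K_coeff_col) auto
  \<comment> \<open>\<open>?S 0\<close>, that is \<open>p k\<close> times \<phi>_\<epsilon>, is no
    block of H. The extra terms \<open>two_X * p k\<close> in row 1 and \<open>- p k\<close> in row
    2 of the first column stand in for it.\<close>
  have "lead_coeffs k p t * cheb r \<epsilon> - p (k + 1 - t) * (if \<epsilon> = 0 then 0 else cheb r (\<epsilon> - 1))
     = ?S t - (if 2 \<le> t then two_X * ?S (t - 1) else 0) + (if 3 \<le> t then ?S (t - 2) else 0)"
  proof (cases "t = 1")
    case True
    then show ?thesis using assms horner_1 [of k r p \<epsilon>] unfolding c
      by (simp add: lead_coeffs_def algebra_simps)
  next
    case False
    then have "2 \<le> t" "t \<le> k" using assms by auto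
    then show ?thesis unfolding c horner_rec [OF \<open>2 \<le> t\<close> \<open>t \<le> k\<close>]
      by (cases "t = 2") (auto simp: lead_coeffs_def algebra_simps)
  qed
  then have M: "lead_coeffs k p t * cheb r \<epsilon> + (if \<epsilon> = 0 then 0 else - p (k + 1 - t) * cheb r (\<epsilon> - 1))
     = ?S t - (if 2 \<le> t then two_X * ?S (t - 1) else 0) + (if 3 \<le> t then ?S (t - 2) else 0)"
    by (cases "\<epsilon> = 0") simp_all
  have P: "(if t = k - \<epsilon> then \<Sum>i = 0..k. cheb r i * p i else 0) =
      (if t = k - \<epsilon> then ?S t else 0) + (if t = k - \<epsilon> then \<Sum>i<\<epsilon>. cheb r i * p i else 0)"
    using assms by (simp add: sum_split_horner [of \<epsilon> k])
  show ?thesis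
    unfolding K M_coeff_row_sum [OF assms(1,2,4,5)] M P by simp
qed

text \<open>Subtracting half of the lowest coefficient from each shift turns the one-sided
  correction -\<lambda> p_{k+1-t} of the recurrence into a symmetric one:
  \<open>h t - two_X * h (t - 1) + h (t - 2)\<close> is half of p_{k-t} - p_{k+2-t}, free of
  \<lambda>. These are the generic entries of M.\<close>

lemma M0_coeff_right:
  assumes "2 \<le> k" "1 \<le> t" "t \<le> k"
  shows "M0_coeff k p t
     + (\<Sum>i = 1..k - 1. K_coeff (k - 1) two_X (cheb 2 1) i t
          * (- horner k 1 p 0 i + [:1/2:] * p (k - i)))
    = (if t = k then \<Sum>i = 0..k. cheb 1 i * p i else 0)"
proof -
  define h where "h i = horner k 1 p 0 i - [:1/2:] * p (k - i)" for i
  have two_X: "two_X = 2 * cheb 1 1" by (simp add: mult_pCons_right numeral_poly)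
  have split: "[:1/2:] * q + [:1/2:] * q = q" for q :: "complex poly"
    using half_mult_2 [of q] by (simp only: mult_2 distrib_left)
  have K: "(\<Sum>i = 1..k - 1. K_coeff (k - 1) two_X (cheb 2 1) i t
        * (- horner k 1 p 0 i + [:1/2:] * p (k - i))) =
    - (if t < k then h t else 0) + (if 2 \<le> t then two_X * h (t - 1) else 0)
     - (if 3 \<le> t then h (t - 2) else 0)"
    using assms by (subst sum_K_coeff_col) (auto simp: h_def algebra_simps)
  have M: "M0_coeff k p t = (if t = k then [:1/2:] * p 0 else 0)
     + h t - (if 2 \<le> t then two_X * h (t - 1) else 0) + (if 3 \<le> t then h (t - 2) else 0)"
  proof (cases "t = 1")
    case True
    have "M0_coeff k p 1 = cheb 1 1 * p k + [:1/2:] * p (k - 1)"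
      by (simp add: M0_coeff_def two_X distrib_left mult.assoc del: cheb.simps)
    also have "\<dots> = h 1"
      using horner_1 [of k 1 p 0] split [of "p (k - 1)"] assms
      by (simp add: h_def algebra_simps del: cheb.simps(2))
    finally show ?thesis using True assms by simp
  next
    case False
    then have t: "2 \<le> t" using assms by auto
    have ht: "h t = two_X * horner k 1 p 0 (t - 1) - horner k 1 p 0 (t - 2)
       + (p (k - t) - cheb 1 1 * p (k + 1 - t)) - [:1/2:] * p (k - t)"
      unfolding h_def horner_rec [OF t assms(3)] two_X by (simp add: algebra_simps del: cheb.simps(2))
    have "two_X * ([:1/2:] * p (k + 1 - t)) = cheb 1 1 * p (k + 1 - t)"
      unfolding two_X using half_mult_2 [of "cheb 1 1 * p (k + 1 - t)"]
      by (simp only: mult_ac)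
    then have h1: "two_X * h (t - 1) = two_X * horner k 1 p 0 (t - 1) - cheb 1 1 * p (k + 1 - t)"
      using t assms by (simp add: h_def right_diff_distrib Suc_diff_le)
    have h2: "h (t - 2) = horner k 1 p 0 (t - 2) - [:1/2:] * p (k + 2 - t)"
      using t assms by (simp add: h_def)
    have "M0_coeff k p t = [:1/2:] * (if t = k then 2 * p 0 else p (k - t))
       - [:1/2:] * (if t = 2 then 2 * p k else p (k + 2 - t))"
      using t unfolding M0_coeff_def by (simp add: right_diff_distrib)
    also have "[:1/2:] * (if t = k then 2 * p 0 else p (k - t)) =
        (if t = k then [:1/2:] * p 0 else 0) + [:1/2:] * p (k - t)"
      using split [of "p 0"] by simp
    \<comment> \<open>The doubled \<open>p k\<close> in row 2 supplies \<open>h 0\<close>, which is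
      no block of H.\<close>
    also have "[:1/2:] * (if t = 2 then 2 * p k else p (k + 2 - t)) =
        (if t = 2 then h 0 else 0) + [:1/2:] * p (k + 2 - t)"
      using split [of "p k"] by (simp add: h_def)
    finally have M0: "M0_coeff k p t = (if t = k then [:1/2:] * p 0 else 0) + [:1/2:] * p (k - t)
       - ((if t = 2 then h 0 else 0) + [:1/2:] * p (k + 2 - t))" .
    have "h t - two_X * h (t - 1) + h (t - 2) = [:1/2:] * p (k - t) - [:1/2:] * p (k + 2 - t)"
      unfolding ht h1 h2 using split [of "p (k - t)"] by (simp add: algebra_simps)
    then show ?thesis using t unfolding M0 by (auto simp: algebra_simps)
  qed
  \<comment> \<open>The missing half of \<open>p 0\<close> comes from the doubled \<open>p 0\<close>
    in the last row of M.\<close>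
  have "h k = (\<Sum>i = 0..k. cheb 1 i * p i) - [:1/2:] * p 0"
    using sum_split_horner [of 0 k 1 p] by (simp add: h_def)
  then show ?thesis
    unfolding K M using assms by (auto split: if_splits)
qed

section \<open>Left identity: columns of M against \<open>D_2\<close>, completed by the shifts in
  G\<close>

lemma horner_rev:
  assumes "i \<le> k"
  shows "horner k s p 0 i = (\<Sum>t = 0..i. p (k - t) * cheb s (i - t))"
  unfolding horner_def
  by (rule sum.reindex_bij_witness [where i = "\<lambda>t. i - t" and j = "\<lambda>l. i - l"])
     (use assms in auto)

lemma M_coeff_col_sum:
  assumes "2 \<le> k" "\<epsilon> \<le> k - 1" "1 \<le> s" "s \<le> \<epsilon> + 1"
  shows "(\<Sum>t = 1..k - \<epsilon>. M_coeff k \<epsilon> p t s * cheb 2 (k - \<epsilon> - t)) =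
    (if s = 1 then horner k 2 p 0 (k - \<epsilon>)
     else if s = 2 then p (\<epsilon> - 1) - horner k 2 p 0 (k - \<epsilon> - 1) else p (\<epsilon> + 1 - s))"
proof -
  define N where "N = k - \<epsilon>"
  have N: "1 \<le> N" "N \<le> k" "k + 1 - N = \<epsilon> + 1" using assms by (auto simp: N_def)
  consider "s = 1" | "s = 2" | "3 \<le> s" using assms by linarith
  then show ?thesis
  proof cases
    case 1
    \<comment> \<open>For N = 1 this again uses \<phi>_{-1} = 0. It merges the two extra multiples
      of \<open>p k\<close> in column 1 into the top term of the shift.\<close>
    have u: "cheb 2 N = two_X * cheb 2 (N - 1) - (if 2 \<le> N then cheb 2 (N - 2) else 0)"
      using N cheb_rec [of N 2] by (cases "N = 1") auto
    have "(\<Sum>t = 1..N. lead_coeffs k p t * cheb 2 (N - t)) =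
       (\<Sum>t = 1..N. p (k - t) * cheb 2 (N - t)
          + (if t = 1 then two_X * p k * cheb 2 (N - 1) else 0)
          - (if t = 2 then p k * cheb 2 (N - 2) else 0))"
      by (rule sum.cong) (auto simp: lead_coeffs_def algebra_simps)
    also have "\<dots> = p k * cheb 2 N + (\<Sum>t = 1..N. p (k - t) * cheb 2 (N - t))"
      unfolding u using N by (auto simp: sum.distrib sum_subtractf algebra_simps)
    also have "\<dots> = horner k 2 p 0 N"
      using N by (simp add: horner_rev sum.atLeast_Suc_atMost)
    finally show ?thesis using 1 by (simp add: M_coeff_def N_def)
  next
    case 2
    have "(\<Sum>t = 1..N. M_coeff k \<epsilon> p t s * cheb 2 (N - t)) =
       (\<Sum>t = 1..N. (if t = N then p (\<epsilon> - 1) else 0) - p (k + 1 - t) * cheb 2 (N - t))"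
      by (rule sum.cong) (use 2 N in \<open>auto simp: M_coeff_def simp flip: N_def\<close>)
    also have "\<dots> = p (\<epsilon> - 1) - (\<Sum>t = 1..N. p (k + 1 - t) * cheb 2 (N - t))"
      using N by (simp add: sum_subtractf)
    also have "(\<Sum>t = 1..N. p (k + 1 - t) * cheb 2 (N - t)) = horner k 2 p 0 (N - 1)"
      using N by (simp add: horner_rev)
        (rule sum.reindex_bij_witness [where i = Suc and j = "\<lambda>t. t - 1"], auto)
    finally show ?thesis using 2 by (simp add: N_def)
  next
    case 3
    have "(\<Sum>t = 1..N. M_coeff k \<epsilon> p t s * cheb 2 (N - t)) =
       (\<Sum>t = 1..N. if t = N then p (\<epsilon> + 1 - s) else 0)"
      by (rule sum.cong) (use 3 in \<open>auto simp: M_coeff_def simp flip: N_def\<close>)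
    then show ?thesis using 3 N by (simp add: N_def)
  qed
qed

text \<open>Both sides satisfy the same recurrence in \<open>j\<close>, so two initial cases
  suffice. This is how G can be built from the second kind for either basis: the kind enters only
  through \<phi>_1 in the last row of \<open>K_1\<close>.\<close>

lemma cheb_conv_2:
  assumes "r \<in> {1, 2}"
  shows "cheb r (Suc (Suc j)) = cheb r 1 * cheb 2 (Suc j) - cheb 2 j"
proof (induction j rule: induct_nat_012)
  case 0
  then show ?case by (simp add: algebra_simps)
next
  case 1
  have "cheb 2 1 = two_X" by simp
  then show ?case by (simp add: algebra_simps)
next
  case (ge2 j)
  have "cheb r (Suc (Suc (Suc (Suc j)))) =
      two_X * cheb r (Suc (Suc (Suc j))) - cheb r (Suc (Suc j))"
    by simp
  also have "\<dots> = cheb r 1 * (two_X * cheb 2 (Suc (Suc j)) - cheb 2 (Suc j))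
      - (two_X * cheb 2 (Suc j) - cheb 2 j)"
    unfolding ge2 by (simp only: algebra_simps)
  finally show ?case by simp
qed

text \<open>\<open>cheb_conv_2\<close> applied to every term of index at least 2. The left-hand side
  is what the last column of the left identity produces for \<epsilon> \<ge> 1.\<close>

lemma horner_full:
  assumes "2 \<le> k" "r \<in> {1, 2}"
  shows "cheb r 1 * horner k 2 p 0 (k - 1) - horner k 2 p 0 (k - 2) + p 0 =
    (\<Sum>i = 0..k. cheb r i * p i)"
proof -
  obtain j where k: "k = Suc (Suc j)"
    using assms by (metis add_2_eq_Suc le_Suc_ex)
  have "(\<Sum>i = 0..k. cheb r i * p i) =
      p 0 + cheb r 1 * p 1 + (\<Sum>i = 0..j. cheb r (Suc (Suc i)) * p (Suc (Suc i)))"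
    by (simp add: k sum.atLeast0_atMost_Suc_shift add.assoc
        del: sum.cl_ivl_Suc cheb.simps(2,3))
  also have "(\<Sum>i = 0..j. cheb r (Suc (Suc i)) * p (Suc (Suc i))) =
      cheb r 1 * (\<Sum>i = 0..j. cheb 2 (Suc i) * p (Suc (Suc i)))
      - (\<Sum>i = 0..j. cheb 2 i * p (Suc (Suc i)))"
    unfolding cheb_conv_2 [OF assms(2)] sum_distrib_left sum_subtractf [symmetric]
    by (rule sum.cong) (simp_all only: algebra_simps)
  also have "(\<Sum>i = 0..j. cheb 2 i * p (Suc (Suc i))) = horner k 2 p 0 (k - 2)"
    by (simp add: horner_def k)
  also have "(\<Sum>i = 0..j. cheb 2 (Suc i) * p (Suc (Suc i))) = horner k 2 p 0 (k - 1) - p 1"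
    by (simp add: horner_def k sum.atLeast0_atMost_Suc_shift del: sum.cl_ivl_Suc cheb.simps(2,3))
  finally show ?thesis by (simp add: right_diff_distrib)
qed

text \<open>The correction of \<open>horner_rec\<close> disappears because \<phi>_1 =
  2\<lambda>\<phi>_0 for the second kind.\<close>

lemma horner_2_rec:
  assumes "2 \<le> i" "i \<le> k"
  shows "horner k 2 p 0 i = two_X * horner k 2 p 0 (i - 1) - horner k 2 p 0 (i - 2) + p (k - i)"
  using horner_rec [OF assms, of 2 p 0] by simp

lemma M_coeff_left:
  assumes "2 \<le> k" "\<epsilon> \<le> k - 1" "r \<in> {1, 2}" "\<epsilon> = 0 \<longrightarrow> r \<noteq> 1" "1 \<le> s" "s \<le> \<epsilon> + 1"
  shows "(\<Sum>t = 1..k - \<epsilon>. M_coeff k \<epsilon> p t s * cheb 2 (k - \<epsilon> - t))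
     + (\<Sum>i = 1..\<epsilon>. K_coeff \<epsilon> two_X (cheb r 1) i s * - horner k 2 p 0 (k - \<epsilon> - 1 + i))
    = (if s = \<epsilon> + 1 then \<Sum>i = 0..k. cheb r i * p i else 0)"
proof -
  let ?R = "horner k 2 p 0"
  define m where "m = k - \<epsilon> - 1"
  have m: "k - \<epsilon> = m + 1" "m + 1 + \<epsilon> = k" using assms by (auto simp: m_def)
  have K: "(\<Sum>i = 1..\<epsilon>. K_coeff \<epsilon> two_X (cheb r 1) i s * - ?R (m + i)) =
     (if s \<le> \<epsilon> then - ?R (m + s) else 0)
     + (if 2 \<le> s then (if s = \<epsilon> + 1 then cheb r 1 else two_X) * ?R (m + s - 1) else 0)
     - (if 3 \<le> s then ?R (m + s - 2) else 0)"
    using assms by (subst sum_K_coeff_col) auto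
  have full: "cheb r 1 * ?R (k - 1) - ?R (k - 2) + p 0 = (\<Sum>i = 0..k. cheb r i * p i)"
    by (rule horner_full) (use assms in auto)
  \<comment> \<open>The shifts in G start at \<open>m + 1\<close>. Column 1 of M cancels the first
    of them, and column 2 provides \<open>?R m\<close>, which the recurrence needs but G does not
    contain.\<close>
  have C: "(\<Sum>t = 1..k - \<epsilon>. M_coeff k \<epsilon> p t s * cheb 2 (k - \<epsilon> - t)) =
    (if s = 1 then ?R (m + 1) else if s = 2 then p (\<epsilon> - 1) - ?R m else p (\<epsilon> + 1 - s))"
    using M_coeff_col_sum [OF assms(1,2,5,6), of p] by (simp add: m)
  show ?thesis
  proof (cases "s = \<epsilon> + 1")
    case False
    then have rec: "?R (m + s) = two_X * ?R (m + s - 1) - ?R (m + s - 2) + p (\<epsilon> + 1 - s)" if "2 \<le> s"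
    proof -
      have "k - (m + s) = \<epsilon> + 1 - s" using m by auto
      then show ?thesis using horner_2_rec [of "m + s" k p] that False assms m by auto
    qed
    consider "s = 1" | "s = 2" | "3 \<le> s" using assms by linarith
    then show ?thesis
    proof cases
      case 1
      then show ?thesis
        unfolding C K m_def [symmetric] using False assms by simp
    next
      case 2
      then have "\<epsilon> + 1 - s = \<epsilon> - 1" by simp
      then show ?thesis
        unfolding C K m_def [symmetric] using 2 rec False assms by simp
    next
      case 3
      then show ?thesis
        unfolding C K m_def [symmetric] using rec False assms by simp
    qed
  next
    case True
    consider "\<epsilon> = 0" "s = 1" | "\<epsilon> = 1" "s = 2" | "2 \<le> \<epsilon>" "3 \<le> s" using True by linarith
    then show ?thesis
    proof cases
      case 1
      \<comment> \<open>Here \<open>K_1\<close> is empty and the kind is not the first, so the full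
        shift \<open>?R k\<close> alone must be P.\<close>
      then have r: "cheb r 1 = two_X" and "m + 1 = k" using assms m by auto
      then show ?thesis
        unfolding C using 1 full horner_2_rec [of k k p] assms(1) by (simp only: r) simp
    next
      case 2
      have "k - 2 = m" "k - 1 = m + 1" using 2 m by auto
      then show ?thesis
        unfolding C K m_def [symmetric] using full 2 by (simp add: algebra_simps del: cheb.simps)
    next
      case 3
      have "k - 2 = m + s - 2" "k - 1 = m + s - 1" using True m 3 by auto
      then have "cheb r 1 * ?R (m + s - 1) - ?R (m + s - 2) + p 0 = (\<Sum>i = 0..k. cheb r i * p i)"
        using full by (simp only:)
      then show ?thesis
        unfolding C K m_def [symmetric] using True 3 by (simp add: algebra_simps del: cheb.simps)
    qed
  qed
qed

text \<open>Summed form of \<phi>_j^(1) = (\<phi>_j^(2) - \<phi>_{j-2}^(2))/2. The index j = 0,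
  where the subtracted term is absent, accounts for the additional \<open>p 0\<close>.\<close>

lemma M0_coeff_left:
  assumes "2 \<le> k"
  shows "(\<Sum>t = 1..k. M0_coeff k p t * cheb 2 (k - t)) = (\<Sum>i = 0..k. cheb 1 i * p i)"
proof -
  let ?R = "horner k 2 p 0"
  have two_X: "two_X = 2 * cheb 1 1" by (simp add: mult_pCons_right numeral_poly)
  \<comment> \<open>Exceptional rows become indicator terms added to a uniform summand, so that rows
    2 and k may coincide.\<close>
  have "(\<Sum>t = 1..k. M0_coeff k p t * cheb 2 (k - t)) =
     (\<Sum>t = 1..k. [:1/2:] * (p (k - t) * cheb 2 (k - t)
        + (if t = 1 then two_X * p k * cheb 2 (k - 1) else 0)
        - (if t = 2 then p k * cheb 2 (k - 2) else 0)
        + (if t = k then p 0 else 0)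
        - (if t = 1 then 0 else p (k + 2 - t) * cheb 2 (k - t))))"
  proof (rule sum.cong [OF refl])
    fix t assume t: "t \<in> {1..k}"
    consider "t = 1" | "t = 2" "k = 2" | "t = 2" "k \<noteq> 2" | "3 \<le> t" using t by fastforce
    then show "M0_coeff k p t * cheb 2 (k - t) = [:1/2:] * (p (k - t) * cheb 2 (k - t)
        + (if t = 1 then two_X * p k * cheb 2 (k - 1) else 0)
        - (if t = 2 then p k * cheb 2 (k - 2) else 0)
        + (if t = k then p 0 else 0)
        - (if t = 1 then 0 else p (k + 2 - t) * cheb 2 (k - t)))"
      using assms by cases (simp_all add: M0_coeff_def mult.assoc algebra_simps)
  qed
  also have "\<dots> = [:1/2:] * ((\<Sum>t = 1..k. p (k - t) * cheb 2 (k - t))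
     + two_X * p k * cheb 2 (k - 1) - p k * cheb 2 (k - 2) + p 0
     - (\<Sum>t = 1..k. if t = 1 then 0 else p (k + 2 - t) * cheb 2 (k - t)))"
    unfolding sum_distrib_left [symmetric] using assms by (simp add: sum.distrib sum_subtractf)
  also have "(\<Sum>t = 1..k. if t = 1 then 0 else p (k + 2 - t) * cheb 2 (k - t)) = ?R (k - 2)"
  proof -
    have "(\<Sum>t = 1..k. if t = 1 then 0 else p (k + 2 - t) * cheb 2 (k - t)) =
        (\<Sum>t = 2..k. p (k + 2 - t) * cheb 2 (k - t))"
      by (rule sum.mono_neutral_cong_right) auto
    moreover have "Suc (Suc (k - 2)) = k" using assms by simp
    ultimately show ?thesis
      using sum.shift_bounds_cl_nat_ivl [of "\<lambda>t. p (k + 2 - t) * cheb 2 (k - t)" 0 2 "k - 2"]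
      by (simp add: horner_rev numeral_2_eq_2 del: sum.cl_ivl_Suc)
  qed
  also have "(\<Sum>t = 1..k. p (k - t) * cheb 2 (k - t)) + two_X * p k * cheb 2 (k - 1)
      - p k * cheb 2 (k - 2) = ?R k"
    using assms by (simp add: horner_rev sum.atLeast_Suc_atMost [of 0] cheb_rec [of k 2] algebra_simps)
  also have "[:1/2:] * (?R k + p 0 - ?R (k - 2)) =
      [:1/2:] * (2 * (cheb 1 1 * ?R (k - 1) - ?R (k - 2) + p 0))"
    unfolding horner_2_rec [OF assms order_refl] two_X by (simp add: algebra_simps del: cheb.simps)
  also have "\<dots> = (\<Sum>i = 0..k. cheb 1 i * p i)"
    using horner_full [of k 1 p] assms by simp
  finally show ?thesis .
qed

section \<open>Block matrices with scalar blocks\<close>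

text \<open>Blocks are counted from 1, positions inside a block from 0.\<close>

definition block_idx :: "nat \<Rightarrow> nat \<Rightarrow> nat \<Rightarrow> nat" where
  "block_idx n s a = (s - 1) * n + a"

lemma block_idx_1 [simp]: "block_idx n (Suc 0) a = a"
  by (simp add: block_idx_def)

lemma block_idx_less [simp]:
  assumes "s \<in> {1..p}" "a < n"
  shows "block_idx n s a < p * n"
proof -
  have "block_idx n s a < (s - 1) * n + n" using assms by (simp add: block_idx_def)
  also have "\<dots> = s * n" using assms by (cases s) auto
  also have "\<dots> \<le> p * n" using assms by simp
  finally show ?thesis .
qed

lemma block_idx_cases:
  assumes "i < p * n"
  obtains s a where "s \<in> {1..p}" "a < n" "i = block_idx n s a"
proof -
  have n: "n > 0" using assms by (cases n) auto
  then have "i div n < p" using assms by (simp add: less_mult_imp_div_less)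
  then show ?thesis using that [of "i div n + 1" "i mod n"] n by (simp add: block_idx_def)
qed

lemma block_mat_carrier [simp]: "block_mat n p q B \<in> carrier_mat (p * n) (q * n)"
  "dim_row (block_mat n p q B) = p * n" "dim_col (block_mat n p q B) = q * n"
  by (simp_all add: block_mat_def)

lemma block_mat_index [simp]:
  assumes "s \<in> {1..p}" "t \<in> {1..q}" "a < n" "b < n"
  shows "block_mat n p q B $$ (block_idx n s a, block_idx n t b) = B s t $$ (a, b)"
  using assms block_idx_less [OF assms(1,3)] block_idx_less [OF assms(2,4)]
  by (auto simp add: block_mat_def block_idx_def)

lemma block_mat_eqI:
  assumes "A \<in> carrier_mat (p * n) (q * n)" "B \<in> carrier_mat (p * n) (q * n)"
    and "\<And>s t a b. s \<in> {1..p} \<Longrightarrow> t \<in> {1..q} \<Longrightarrow> a < n \<Longrightarrow> b < n \<Longrightarrow>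
      A $$ (block_idx n s a, block_idx n t b) = B $$ (block_idx n s a, block_idx n t b)"
  shows "A = B"
proof (rule eq_matI)
  fix i j assume "i < dim_row B" "j < dim_col B"
  then have "i < p * n" "j < q * n" using assms by auto
  then show "A $$ (i, j) = B $$ (i, j)"
    by (metis block_idx_cases assms(3))
qed (use assms in auto)

lemma block_vec_eqI:
  assumes "v \<in> carrier_vec (p * n)" "w \<in> carrier_vec (p * n)"
    and "\<And>s a. s \<in> {1..p} \<Longrightarrow> a < n \<Longrightarrow> v $ (block_idx n s a) = w $ (block_idx n s a)"
  shows "v = w"
proof (rule eq_vecI)
  fix i assume "i < dim_vec w"
  then have "i < p * n" using assms by auto
  then show "v $ i = w $ i"
    by (metis block_idx_cases assms(3))
qed (use assms in auto)

lemma block_mat_cong: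
  assumes "\<And>s t a b. s \<in> {1..p} \<Longrightarrow> t \<in> {1..q} \<Longrightarrow> a < n \<Longrightarrow> b < n \<Longrightarrow>
      B s t $$ (a, b) = B' s t $$ (a, b)"
  shows "block_mat n p q B = block_mat n p q B'"
  by (rule block_mat_eqI [where n = n]) (use assms in auto)

lemma sum_blocks:
  "(\<Sum>i<q * n. f i) = (\<Sum>u = 1..q. \<Sum>c<n. f (block_idx n u c))" for f :: "nat \<Rightarrow> 'a::comm_monoid_add"
proof -
  have "sum f {m..<m + n} = (\<Sum>c<n. f (m + c))" for m
    by (rule sum.reindex_bij_witness [where i = "\<lambda>c. m + c" and j = "\<lambda>i. i - m"]) auto
  then have "(\<Sum>i<q * n. f i) = (\<Sum>u<q. \<Sum>c<n. f (u * n + c))"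
    using sum.nat_group [of f n q] by simp
  also have "\<dots> = (\<Sum>u = 1..q. \<Sum>c<n. f (block_idx n u c))"
    by (rule sum.reindex_bij_witness [where i = "\<lambda>u. u - 1" and j = Suc])
      (auto simp: block_idx_def)
  finally show ?thesis .
qed

lemma transpose_block_mat:
  assumes "\<And>s t. s \<in> {1..p} \<Longrightarrow> t \<in> {1..q} \<Longrightarrow> B s t \<in> carrier_mat n n"
  shows "transpose_mat (block_mat n p q B) = block_mat n q p (\<lambda>s t. transpose_mat (B t s))"
proof (rule block_mat_eqI [where n = n])
  fix s t a b assume *: "s \<in> {1..q}" "t \<in> {1..p}" "a < n" "b < n"
  show "transpose_mat (block_mat n p q B) $$ (block_idx n s a, block_idx n t b) =
        block_mat n q p (\<lambda>s t. transpose_mat (B t s)) $$ (block_idx n s a, block_idx n t b)"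
    using assms [OF *(2,1)] * block_idx_less [OF *(1,3)] block_idx_less [OF *(2,4)]
    by simp
qed simp_all

lemma eval_block_mat:
  assumes "\<And>s t. s \<in> {1..p} \<Longrightarrow> t \<in> {1..q} \<Longrightarrow> B s t \<in> carrier_mat n n"
  shows "eval_mat (block_mat n p q B) c = block_mat n p q (\<lambda>s t. eval_mat (B s t) c)"
proof (rule block_mat_eqI [where n = n])
  fix s t a b assume *: "s \<in> {1..p}" "t \<in> {1..q}" "a < n" "b < n"
  show "eval_mat (block_mat n p q B) c $$ (block_idx n s a, block_idx n t b) =
        block_mat n p q (\<lambda>s t. eval_mat (B s t) c) $$ (block_idx n s a, block_idx n t b)"
    using assms [OF *(1,2)] * block_idx_less [OF *(1,3)] block_idx_less [OF *(2,4)]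
    by (simp add: eval_mat_def)
qed (simp_all add: eval_mat_def)

abbreviation scalar_blocks ::
  "nat \<Rightarrow> nat \<Rightarrow> nat \<Rightarrow> (nat \<Rightarrow> nat \<Rightarrow> 'a) \<Rightarrow> 'a::comm_ring_1 mat" where
  "scalar_blocks n p q \<beta> \<equiv> block_mat n p q (\<lambda>s t. \<beta> s t \<cdot>\<^sub>m 1\<^sub>m n)"

lemma transpose_scalar_blocks:
  "transpose_mat (scalar_blocks n p q \<beta>) = scalar_blocks n q p (\<lambda>s t. \<beta> t s)"
  by (subst transpose_block_mat) (auto intro: block_mat_cong)

lemma eval_scalar_blocks:
  "eval_mat (scalar_blocks n p q \<beta>) c = scalar_blocks n p q (\<lambda>s t. poly (\<beta> s t) c)"
  by (subst eval_block_mat) (auto intro!: block_mat_cong simp: eval_mat_def)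

text \<open>A multiple of the identity never mixes positions inside a block. Hence block identities
  split into scalar ones, one for each position \<open>(a, b)\<close>.\<close>

lemma block_mat_mult_scalar_blocks:
  fixes B :: "nat \<Rightarrow> nat \<Rightarrow> 'a::comm_ring_1 mat"
  assumes "s \<in> {1..p}" "t \<in> {1..r}" "a < n" "b < n"
  shows "(block_mat n p q B * scalar_blocks n q r \<beta>) $$ (block_idx n s a, block_idx n t b) =
    (\<Sum>u = 1..q. B s u $$ (a, b) * \<beta> u t)"
proof -
  have "(block_mat n p q B * scalar_blocks n q r \<beta>) $$ (block_idx n s a, block_idx n t b) =
    (\<Sum>i<q * n. block_mat n p q B $$ (block_idx n s a, i) *
       scalar_blocks n q r \<beta> $$ (i, block_idx n t b))"
    using block_idx_less [OF assms(1,3)] block_idx_less [OF assms(2,4)]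
    by (simp add: scalar_prod_def lessThan_atLeast0)
  also have "\<dots> = (\<Sum>u = 1..q. \<Sum>c<n. if c = b then B s u $$ (a, b) * \<beta> u t else 0)"
    unfolding sum_blocks using assms by (intro sum.cong refl) auto
  also have "\<dots> = (\<Sum>u = 1..q. B s u $$ (a, b) * \<beta> u t)"
    using assms by simp
  finally show ?thesis .
qed

lemma scalar_blocks_mult_block_mat:
  fixes B :: "nat \<Rightarrow> nat \<Rightarrow> 'a::comm_ring_1 mat"
  assumes "s \<in> {1..p}" "t \<in> {1..r}" "a < n" "b < n"
  shows "(scalar_blocks n p q \<beta> * block_mat n q r B) $$ (block_idx n s a, block_idx n t b) =
    (\<Sum>u = 1..q. \<beta> s u * B u t $$ (a, b))"
proof -
  have "(scalar_blocks n p q \<beta> * block_mat n q r B) $$ (block_idx n s a, block_idx n t b) =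
    (\<Sum>i<q * n. scalar_blocks n p q \<beta> $$ (block_idx n s a, i) *
       block_mat n q r B $$ (i, block_idx n t b))"
    using block_idx_less [OF assms(1,3)] block_idx_less [OF assms(2,4)]
    by (simp add: scalar_prod_def lessThan_atLeast0)
  also have "\<dots> = (\<Sum>u = 1..q. \<Sum>c<n. if c = a then \<beta> s u * B u t $$ (a, b) else 0)"
    unfolding sum_blocks using assms by (intro sum.cong refl) auto
  also have "\<dots> = (\<Sum>u = 1..q. \<beta> s u * B u t $$ (a, b))"
    using assms by simp
  finally show ?thesis .
qed

lemma scalar_blocks_mult_vec:
  fixes v :: "'a::comm_ring_1 vec"
  assumes "s \<in> {1..p}" "a < n" "v \<in> carrier_vec (q * n)"
  shows "(scalar_blocks n p q \<beta> *\<^sub>v v) $ (block_idx n s a) =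
    (\<Sum>u = 1..q. \<beta> s u * v $ (block_idx n u a))"
proof -
  have "(scalar_blocks n p q \<beta> *\<^sub>v v) $ (block_idx n s a) =
    (\<Sum>i<q * n. scalar_blocks n p q \<beta> $$ (block_idx n s a, i) * v $ i)"
    using block_idx_less [OF assms(1,2)] assms(3)
    by (simp add: scalar_prod_def lessThan_atLeast0)
  also have "\<dots> = (\<Sum>u = 1..q. \<Sum>c<n. if c = a then \<beta> s u * v $ (block_idx n u a) else 0)"
    unfolding sum_blocks using assms by (intro sum.cong refl) auto
  also have "\<dots> = (\<Sum>u = 1..q. \<beta> s u * v $ (block_idx n u a))"
    using assms by simp
  finally show ?thesis .
qed

section \<open>Kernel of an abstract two-by-two block pencil\<close>

lemma zero_mat_mult_vec:
  "x \<in> carrier_vec n \<Longrightarrow> 0\<^sub>m l n *\<^sub>v x = (0\<^sub>v l :: 'a::semiring_0 vec)"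
  by (intro eq_vecI) auto

lemma mult_mat_zero_vec:
  "A \<in> carrier_mat l n \<Longrightarrow> A *\<^sub>v 0\<^sub>v n = (0\<^sub>v l :: 'a::semiring_0 vec)"
  by (intro eq_vecI) auto

text \<open>Pure linear algebra: \<open>ker\<close>, \<open>KD\<close> and \<open>inj\<close> make
  \<open>D\<close> a parametrization of the kernel of \<open>K\<close>, and \<open>LE\<close> is the
  joint injectivity that follows from unitriangularity of \<open>[L, E]\<close>.\<close>

lemma block_pencil_kernel:
  fixes M :: "'a::comm_ring_1 mat"
  assumes M: "M \<in> carrier_mat p q" and L: "L \<in> carrier_mat p m" and K: "K \<in> carrier_mat l q"
    and D: "D \<in> carrier_mat q n" and H: "H \<in> carrier_mat m n"
    and E: "E \<in> carrier_mat p n" and A: "A \<in> carrier_mat n n"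
    and ker: "\<And>v. v \<in> carrier_vec q \<Longrightarrow> K *\<^sub>v v = 0\<^sub>v l \<Longrightarrow> \<exists>x \<in> carrier_vec n. v = D *\<^sub>v x"
    and KD: "K * D = 0\<^sub>m l n"
    and inj: "\<And>x. x \<in> carrier_vec n \<Longrightarrow> D *\<^sub>v x = 0\<^sub>v q \<Longrightarrow> x = 0\<^sub>v n"
    and eq: "M * D + L * H = E * A"
    and LE: "\<And>v u. v \<in> carrier_vec m \<Longrightarrow> u \<in> carrier_vec n \<Longrightarrow> L *\<^sub>v v = E *\<^sub>v u \<Longrightarrow>
      v = 0\<^sub>v m \<and> u = 0\<^sub>v n"
  shows "z \<in> carrier_vec (q + m) \<and> z \<noteq> 0\<^sub>v (q + m) \<and>
      four_block_mat M L K (0\<^sub>m l m) *\<^sub>v z = 0\<^sub>v (p + l) \<longleftrightarrow>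
    (\<exists>x. x \<in> carrier_vec n \<and> x \<noteq> 0\<^sub>v n \<and> A *\<^sub>v x = 0\<^sub>v n \<and> z = (D @\<^sub>r H) *\<^sub>v x)"
    (is "?lhs \<longleftrightarrow> ?rhs")
proof -
  have zero: "0\<^sub>v (i + j) = 0\<^sub>v i @\<^sub>v 0\<^sub>v j" for i j :: nat
    by (intro eq_vecI) auto
  have eqx: "M *\<^sub>v (D *\<^sub>v x) + L *\<^sub>v (H *\<^sub>v x) = E *\<^sub>v (A *\<^sub>v x)" if x: "x \<in> carrier_vec n" for x
  proof -
    have "M *\<^sub>v (D *\<^sub>v x) + L *\<^sub>v (H *\<^sub>v x) = (M * D + L * H) *\<^sub>v x"
      using assoc_mult_mat_vec [OF M D x] assoc_mult_mat_vec [OF L H x]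
        add_mult_distrib_mat_vec [OF mult_carrier_mat [OF M D] mult_carrier_mat [OF L H] x]
      by simp
    then show ?thesis unfolding eq using assoc_mult_mat_vec [OF E A x] by simp
  qed
  have prod: "four_block_mat M L K (0\<^sub>m l m) *\<^sub>v (v @\<^sub>v w) =
      (M *\<^sub>v v + L *\<^sub>v w) @\<^sub>v (K *\<^sub>v v)"
    if v: "v \<in> carrier_vec q" and w: "w \<in> carrier_vec m" for v w
    using four_block_mat_mult_vec [OF M L K zero_carrier_mat v w] mult_mat_vec_carrier [OF K v] w
    by (simp add: zero_mat_mult_vec)
  show ?thesis
  proof
    assume z: ?lhs
    define v w where "v = vec_first z q" and "w = vec_last z m"
    have v: "v \<in> carrier_vec q" and w: "w \<in> carrier_vec m" and zvw: "z = v @\<^sub>v w"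
      using z by (auto simp: v_def w_def)
    have Lw: "L *\<^sub>v w \<in> carrier_vec p" and Mv: "M *\<^sub>v v \<in> carrier_vec p" using L M v w by auto
    have "(M *\<^sub>v v + L *\<^sub>v w) @\<^sub>v (K *\<^sub>v v) = 0\<^sub>v p @\<^sub>v 0\<^sub>v l"
      using z prod [OF v w] unfolding zvw zero by simp
    then have top: "M *\<^sub>v v + L *\<^sub>v w = 0\<^sub>v p" and bot: "K *\<^sub>v v = 0\<^sub>v l"
      using append_vec_eq [of "M *\<^sub>v v + L *\<^sub>v w" p "0\<^sub>v p"] Lw Mv by auto
    obtain x where x: "x \<in> carrier_vec n" and vx: "v = D *\<^sub>v x"
      using ker [OF v bot] by blast
    have Hx: "H *\<^sub>v x \<in> carrier_vec m" and Ax: "A *\<^sub>v x \<in> carrier_vec n" using H A x by auto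
    have LHx: "L *\<^sub>v (H *\<^sub>v x) \<in> carrier_vec p" using L Hx by auto
    \<comment> \<open>Subtracting the upper equation of the kernel from \<open>eqx\<close> cancels
      \<open>M v\<close>; then \<open>LE\<close> yields both \<open>w = H x\<close> and
      \<open>A x = 0\<close>.\<close>
    have "L *\<^sub>v (H *\<^sub>v x - w) = L *\<^sub>v (H *\<^sub>v x) - L *\<^sub>v w"
      by (rule mult_minus_distrib_mat_vec [OF L Hx w])
    also have "\<dots> = E *\<^sub>v (A *\<^sub>v x)"
    proof (rule eq_vecI)
      fix i assume "i < dim_vec (E *\<^sub>v (A *\<^sub>v x))"
      then have i: "i < p" using E by auto
      have 1: "(M *\<^sub>v v) $ i + (L *\<^sub>v w) $ i = 0"
        using arg_cong [OF top, of "\<lambda>y. y $ i"] i L M by auto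
      have 2: "(M *\<^sub>v v) $ i + (L *\<^sub>v (H *\<^sub>v x)) $ i = (E *\<^sub>v (A *\<^sub>v x)) $ i"
        using arg_cong [OF eqx [OF x], of "\<lambda>y. y $ i"] i L M vx by auto
      have "(L *\<^sub>v (H *\<^sub>v x) - L *\<^sub>v w) $ i =
          ((M *\<^sub>v v) $ i + (L *\<^sub>v (H *\<^sub>v x)) $ i) - ((M *\<^sub>v v) $ i + (L *\<^sub>v w) $ i)"
        using i L by simp
      then show "(L *\<^sub>v (H *\<^sub>v x) - L *\<^sub>v w) $ i = (E *\<^sub>v (A *\<^sub>v x)) $ i"
        unfolding 1 2 by simp
    qed (use E L in auto)
    finally have "H *\<^sub>v x - w = 0\<^sub>v m \<and> A *\<^sub>v x = 0\<^sub>v n"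
      using LE [OF minus_carrier_vec [OF Hx w] Ax] by simp
    then have diff: "H *\<^sub>v x - w = 0\<^sub>v m" and Ax0: "A *\<^sub>v x = 0\<^sub>v n" by auto
    have "w = H *\<^sub>v x"
    proof (rule eq_vecI)
      fix i assume "i < dim_vec (H *\<^sub>v x)"
      then show "w $ i = (H *\<^sub>v x) $ i"
        using arg_cong [OF diff, of "\<lambda>y. y $ i"] H w by auto
    qed (use H w in auto)
    then have zx: "z = (D @\<^sub>r H) *\<^sub>v x"
      using mat_mult_append [OF D H x] zvw vx by simp
    moreover have "x \<noteq> 0\<^sub>v n"
    proof
      assume "x = 0\<^sub>v n"
      then have "z = 0\<^sub>v (q + m)"
        using mat_mult_append [OF D H x] mult_mat_zero_vec [OF D] mult_mat_zero_vec [OF H]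
        by (simp add: zx zero)
      with z show False by blast
    qed
    ultimately show ?rhs using x Ax0 by blast
  next
    assume ?rhs
    then obtain x where x: "x \<in> carrier_vec n" "x \<noteq> 0\<^sub>v n" "A *\<^sub>v x = 0\<^sub>v n"
      and z: "z = (D @\<^sub>r H) *\<^sub>v x" by blast
    have z': "z = (D *\<^sub>v x) @\<^sub>v (H *\<^sub>v x)" using mat_mult_append [OF D H x(1)] z by simp
    have Dx: "D *\<^sub>v x \<in> carrier_vec q" and Hx: "H *\<^sub>v x \<in> carrier_vec m" using D H x by auto
    have "K *\<^sub>v (D *\<^sub>v x) = 0\<^sub>v l"
      using assoc_mult_mat_vec [OF K D x(1)] x(1) unfolding KD by (simp add: zero_mat_mult_vec)
    moreover have "M *\<^sub>v (D *\<^sub>v x) + L *\<^sub>v (H *\<^sub>v x) = 0\<^sub>v p"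
      unfolding eqx [OF x(1)] x(3) by (rule mult_mat_zero_vec [OF E])
    ultimately have "four_block_mat M L K (0\<^sub>m l m) *\<^sub>v z = 0\<^sub>v (p + l)"
      unfolding z' prod [OF Dx Hx] zero by simp
    moreover have "z \<noteq> 0\<^sub>v (q + m)"
      using inj [OF x(1)] x(2) Dx append_vec_eq [OF Dx, of "0\<^sub>v q"] unfolding z' zero by auto
    ultimately show ?lhs using Dx Hx z' by auto
  qed
qed


section \<open>The blocks K and D and their evaluation at a point\<close>

lemma K_cheb_eq: "K_cheb n m s = scalar_blocks n m (m + 1) (K_coeff m two_X (cheb s 1))"
  unfolding K_cheb_def by (rule block_mat_cong) (auto simp: K_coeff_def)

lemma D_cheb_eq: "D_cheb n m s = scalar_blocks n (m + 1) 1 (\<lambda>t _. cheb s (m + 1 - t))"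
  unfolding D_cheb_def ..

lemma poly_K_coeff: "poly (K_coeff m a b i j) c = K_coeff m (poly a c) (poly b c) i j"
  by (simp add: K_coeff_def)

lemma eval_mat_carrier [simp]:
  "eval_mat A c \<in> carrier_mat nr nc \<longleftrightarrow> A \<in> carrier_mat nr nc"
  "dim_row (eval_mat A c) = dim_row A" "dim_col (eval_mat A c) = dim_col A"
  by (auto simp: eval_mat_def)

lemma eval_mat_mult:
  assumes "A \<in> carrier_mat nr n" "B \<in> carrier_mat n nc"
  shows "eval_mat (A * B) c = eval_mat A c * eval_mat B c"
proof -
  interpret comm_ring_hom "\<lambda>p. poly p c" by unfold_locales auto
  show ?thesis unfolding eval_mat_def by (rule mat_hom_mult [OF assms])
qed

lemma eval_mat_add:
  assumes "A \<in> carrier_mat nr nc" "B \<in> carrier_mat nr nc"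
  shows "eval_mat (A + B) c = eval_mat A c + eval_mat B c"
  unfolding eval_mat_def by (rule eq_matI) (use assms in auto)

lemma eval_transpose: "eval_mat (transpose_mat A) c = transpose_mat (eval_mat A c)"
  unfolding eval_mat_def by (rule eq_matI) auto

lemma eval_zero_mat [simp]: "eval_mat (0\<^sub>m nr nc) c = 0\<^sub>m nr nc"
  unfolding eval_mat_def by (rule eq_matI) auto

lemma eval_four_block_mat:
  assumes "A \<in> carrier_mat nr1 nc1" "B \<in> carrier_mat nr1 nc2"
    "C \<in> carrier_mat nr2 nc1" "D \<in> carrier_mat nr2 nc2"
  shows "eval_mat (four_block_mat A B C D) c =
    four_block_mat (eval_mat A c) (eval_mat B c) (eval_mat C c) (eval_mat D c)"
  unfolding eval_mat_def by (rule eq_matI) (use assms in auto)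

lemma eval_append_rows:
  assumes "A \<in> carrier_mat nr1 nc" "B \<in> carrier_mat nr2 nc"
  shows "eval_mat (A @\<^sub>r B) c = eval_mat A c @\<^sub>r eval_mat B c"
  unfolding append_rows_def using assms
  by (subst eval_four_block_mat [of _ nr1 nc _ 0 _ nr2]) auto

lemma K_cheb_mult_D_cheb: "K_cheb n m s * D_cheb n m s = 0\<^sub>m (m * n) n"
proof (rule block_mat_eqI [where n = n and p = m and q = 1])
  fix i t a b assume *: "i \<in> {1..m}" "t \<in> {1..1::nat}" "a < n" "b < n"
  have "(K_cheb n m s * D_cheb n m s) $$ (block_idx n i a, block_idx n t b) =
     (\<Sum>u = 1..m + 1. K_coeff m two_X (cheb s 1) i u * (cheb s (m + 1 - u) \<cdot>\<^sub>m 1\<^sub>m n) $$ (a, b))"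
    unfolding K_cheb_eq D_cheb_def by (rule scalar_blocks_mult_block_mat [OF *])
  also have "\<dots> = 0"
    \<comment> \<open>Row i is the recurrence for \<phi>_{m+1-i}; in the last row it is \<phi>_1 -
      \<phi>_1\<phi>_0 = 0.\<close>
    using * cheb_rec [of "m + 1 - i" s] by (subst sum_K_coeff_row) auto
  finally show "(K_cheb n m s * D_cheb n m s) $$ (block_idx n i a, block_idx n t b) =
      0\<^sub>m (m * n) n $$ (block_idx n i a, block_idx n t b)"
    using * block_idx_less [OF *(1,3)] by simp
qed (rule carrier_matI; simp add: K_cheb_eq D_cheb_eq)+

text \<open>Each row has leading coefficient 1 and determines a block of \<open>v\<close> from the
  ones below it, so the last block determines everything.\<close>

lemma K_cheb_kernel:
  assumes v: "v \<in> carrier_vec ((m + 1) * n)" and Kv: "eval_mat (K_cheb n m s) c *\<^sub>v v = 0\<^sub>v (m * n)"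
  shows "\<exists>x \<in> carrier_vec n. v = eval_mat (D_cheb n m s) c *\<^sub>v x"
proof -
  \<comment> \<open>The last block of D is \<phi>_0 I = I, which forces this choice.\<close>
  define x where "x = vec n (\<lambda>a. v $ block_idx n (m + 1) a)"
  have row: "v $ block_idx n i a = (if i = m then poly (cheb s 1) c else poly two_X c) * v $ block_idx n (i + 1) a
      - (if i < m then v $ block_idx n (i + 2) a else 0)"
    if i: "i \<in> {1..m}" and a: "a < n" for i a
  proof -
    have "(eval_mat (K_cheb n m s) c *\<^sub>v v) $ block_idx n i a = 0"
      unfolding Kv using block_idx_less [OF i a] by simp
    then have "(\<Sum>u = 1..m + 1. K_coeff m (poly two_X c) (poly (cheb s 1) c) i u * v $ block_idx n u a) = 0"
      unfolding K_cheb_eq eval_scalar_blocks poly_K_coeff scalar_blocks_mult_vec [OF i a v] .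
    then show ?thesis using i
      by (subst (asm) sum_K_coeff_row) (auto simp: algebra_simps simp del: cheb.simps split: if_splits)
  qed
  \<comment> \<open>\<open>j\<close> counts blocks from the bottom, so that it is also the index of
    the Chebyshev polynomial.\<close>
  have step: "j \<le> m \<longrightarrow> v $ block_idx n (m + 1 - j) a = poly (cheb s j) c * x $ a" if a: "a < n" for j a
  proof (induction j rule: induct_nat_012)
    case 0
    then show ?case using a by (simp add: x_def)
  next
    case 1
    then show ?case using row [of m a] a by (auto simp: x_def simp del: cheb.simps)
  next
    case (ge2 j)
    show ?case
    proof
      assume j: "Suc (Suc j) \<le> m"
      then have e: "m + 1 - Suc (Suc j) + 1 = m + 1 - Suc j" "m + 1 - Suc (Suc j) + 2 = m + 1 - j"
        "m + 1 - Suc (Suc j) \<in> {1..m}" "m + 1 - Suc (Suc j) < m"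
        by auto
      have "v $ block_idx n (m + 1 - Suc (Suc j)) a =
         poly two_X c * v $ block_idx n (m + 1 - Suc j) a - v $ block_idx n (m + 1 - j) a"
        using row [OF e(3) a, unfolded e(1,2)] e(4) by simp
      also have "\<dots> = poly two_X c * (poly (cheb s (Suc j)) c * x $ a) - poly (cheb s j) c * x $ a"
        using ge2 j by simp
      finally show "v $ block_idx n (m + 1 - Suc (Suc j)) a = poly (cheb s (Suc (Suc j))) c * x $ a"
        by (simp add: algebra_simps)
    qed
  qed
  have x: "x \<in> carrier_vec (1 * n)" by (simp add: x_def)
  have "v = eval_mat (D_cheb n m s) c *\<^sub>v x"
  proof (rule block_vec_eqI [OF v])
    fix t a assume *: "t \<in> {1..m + 1}" "a < n"
    show "v $ block_idx n t a = (eval_mat (D_cheb n m s) c *\<^sub>v x) $ block_idx n t a"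
      unfolding D_cheb_eq eval_scalar_blocks scalar_blocks_mult_vec [OF * x]
      using step [OF *(2), of "m + 1 - t"] * by (simp add: diff_le_mono2 [of 1 t "Suc m", simplified])
  qed (rule carrier_vecI; simp add: D_cheb_eq eval_scalar_blocks)
  then show ?thesis using x by auto
qed

lemma D_cheb_injective:
  assumes x: "x \<in> carrier_vec n" and "eval_mat (D_cheb n m s) c *\<^sub>v x = 0\<^sub>v ((m + 1) * n)"
  shows "x = 0\<^sub>v n"
proof (rule eq_vecI)
  fix a assume "a < dim_vec (0\<^sub>v n :: complex vec)"
  then have a: "a < n" by simp
  have x1: "x \<in> carrier_vec (1 * n)" and m: "m + 1 \<in> {1..m + 1}" using x by auto
  have "(eval_mat (D_cheb n m s) c *\<^sub>v x) $ block_idx n (m + 1) a = x $ a"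
    unfolding D_cheb_eq eval_scalar_blocks scalar_blocks_mult_vec [OF m a x1] by simp
  then show "x $ a = 0\<^sub>v n $ a"
    using assms(2) block_idx_less [OF m a] a by simp
qed (use x in simp)

text \<open>Forward substitution: row j \<le> m of the transpose expresses block j of
  \<open>v\<close> by blocks j - 1 and j - 2 and does not see \<open>u\<close>; row m + 1 then
  leaves only \<open>u\<close>.\<close>

lemma K_cheb_transpose_injective:
  assumes v: "v \<in> carrier_vec (m * n)" and u: "u \<in> carrier_vec n"
    and eq: "eval_mat (transpose_mat (K_cheb n m s)) c *\<^sub>v v =
      scalar_blocks n (m + 1) 1 (\<lambda>t _. if t = m + 1 then 1 else 0) *\<^sub>v u"
  shows "v = 0\<^sub>v (m * n) \<and> u = 0\<^sub>v n"
proof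
  have u1: "u \<in> carrier_vec (1 * n)" using u by simp
  have row: "(\<Sum>i = 1..m. K_coeff m (poly two_X c) (poly (cheb s 1) c) i j * v $ block_idx n i a) =
     (if j = m + 1 then u $ a else 0)" if j: "j \<in> {1..m + 1}" and a: "a < n" for j a
    using arg_cong [OF eq, of "\<lambda>w. w $ block_idx n j a"]
    unfolding K_cheb_eq transpose_scalar_blocks eval_scalar_blocks poly_K_coeff
      scalar_blocks_mult_vec [OF j a v] scalar_blocks_mult_vec [OF j a u1] by simp
  have v0: "j \<in> {1..m} \<longrightarrow> v $ block_idx n j a = 0" if a: "a < n" for j a
  proof (induction j rule: less_induct)
    case (less j)
    show ?case
    proof
      assume j: "j \<in> {1..m}"
      then have "2 \<le> j \<Longrightarrow> v $ block_idx n (j - 1) a = 0" "3 \<le> j \<Longrightarrow> v $ block_idx n (j - 2) a = 0"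
        using less by auto
      then show "v $ block_idx n j a = 0"
        using row [of j a] j a by (subst (asm) sum_K_coeff_col) (auto simp del: cheb.simps split: if_splits)
    qed
  qed
  then show "v = 0\<^sub>v (m * n)"
    by (intro block_vec_eqI [OF v]) auto
  show "u = 0\<^sub>v n"
  proof (rule eq_vecI)
    fix a assume "a < dim_vec (0\<^sub>v n :: complex vec)"
    then have a: "a < n" by simp
    then have "(\<Sum>i = 1..m. K_coeff m (poly two_X c) (poly (cheb s 1) c) i (m + 1) * v $ block_idx n i a) = 0"
      using v0 by (intro sum.neutral) auto
    then show "u $ a = 0\<^sub>v n $ a" using row [of "m + 1" a] a by simp
  qed (use u in simp)
qed

text \<open>Serves both sides. Right eigenvectors take l = \<epsilon>, m = k - 1 - \<epsilon>, s =
  r, s' = 2; left ones apply it to the transposed pencil with l and m, and s and s', exchanged. The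
  hypothesis \<open>eq\<close> is \<open>M D + K^T H = E A\<close> at one position inside the
  blocks.\<close>

lemma cheb_pencil_eigenvector:
  fixes \<mu> :: "nat \<Rightarrow> nat \<Rightarrow> complex poly mat" and \<eta> :: "nat \<Rightarrow> complex poly mat"
  assumes A: "A \<in> carrier_mat n n"
    and \<mu>: "\<And>t u. \<mu> t u \<in> carrier_mat n n" and \<eta>: "\<And>i. \<eta> i \<in> carrier_mat n n"
    and eq: "\<And>t a b. t \<in> {1..m + 1} \<Longrightarrow> a < n \<Longrightarrow> b < n \<Longrightarrow>
      (\<Sum>u = 1..l + 1. \<mu> t u $$ (a, b) * cheb s (l + 1 - u))
        + (\<Sum>i = 1..m. K_coeff m two_X (cheb s' 1) i t * \<eta> i $$ (a, b))
      = (if t = m + 1 then A $$ (a, b) else 0)"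
  shows "right_eigenvector (four_block_mat (block_mat n (m + 1) (l + 1) \<mu>)
        (transpose_mat (K_cheb n m s')) (K_cheb n l s) (0\<^sub>m (l * n) (m * n))) c z \<longleftrightarrow>
     (\<exists>x. right_eigenvector A c x \<and> z = eval_mat (D_cheb n l s @\<^sub>r block_col n m \<eta>) c *\<^sub>v x)"
proof -
  let ?M = "block_mat n (m + 1) (l + 1) \<mu>" and ?H = "block_col n m \<eta>"
  let ?L = "transpose_mat (K_cheb n m s')" and ?K = "K_cheb n l s" and ?D = "D_cheb n l s"
  let ?E = "\<lambda>one. scalar_blocks n (m + 1) 1 (\<lambda>t _. if t = m + 1 then one else 0)"
  have M: "?M \<in> carrier_mat ((m + 1) * n) ((l + 1) * n)" and H: "?H \<in> carrier_mat (m * n) n"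
    and L: "?L \<in> carrier_mat ((m + 1) * n) (m * n)" and K: "?K \<in> carrier_mat (l * n) ((l + 1) * n)"
    and D: "?D \<in> carrier_mat ((l + 1) * n) n"
    by (rule carrier_matI; simp add: K_cheb_eq D_cheb_eq)+
  have E: "(?E 1 :: complex poly mat) \<in> carrier_mat ((m + 1) * n) n"
    "(?E 1 :: complex mat) \<in> carrier_mat ((m + 1) * n) n"
    by (rule carrier_matI; simp)+
  \<comment> \<open>\<open>A\<close> is read as a single block so that the product rule for scalar
    blocks applies to \<open>E A\<close>.\<close>
  have A1: "block_mat n 1 1 (\<lambda>_ _. A) = A"
    by (rule eq_matI) (use A in \<open>auto simp: block_mat_def\<close>)
  have "?M * ?D + ?L * ?H = ?E 1 * A"
  proof (rule block_mat_eqI [where n = n and q = 1])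
    fix t t' a b assume *: "t \<in> {1..m + 1}" "t' \<in> {1..1::nat}" "a < n" "b < n"
    have lt: "block_idx n t a < (m + 1) * n" "block_idx n t' b < n"
      using block_idx_less [OF *(1,3)] block_idx_less [OF *(2,4)] by simp_all
    have "(?M * ?D + ?L * ?H) $$ (block_idx n t a, block_idx n t' b) =
      (?M * ?D) $$ (block_idx n t a, block_idx n t' b) + (?L * ?H) $$ (block_idx n t a, block_idx n t' b)"
      using L H lt by simp
    also have "\<dots> = (\<Sum>u = 1..l + 1. \<mu> t u $$ (a, b) * cheb s (l + 1 - u))
        + (\<Sum>i = 1..m. K_coeff m two_X (cheb s' 1) i t * \<eta> i $$ (a, b))"
      unfolding D_cheb_eq K_cheb_eq transpose_scalar_blocks
        block_mat_mult_scalar_blocks [OF *] scalar_blocks_mult_block_mat [OF *] ..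
    also have "\<dots> = (?E 1 * block_mat n 1 1 (\<lambda>_ _. A)) $$ (block_idx n t a, block_idx n t' b)"
      unfolding eq [OF *(1,3,4)] scalar_blocks_mult_block_mat [OF *] by simp
    finally show "(?M * ?D + ?L * ?H) $$ (block_idx n t a, block_idx n t' b) =
        (?E 1 * A) $$ (block_idx n t a, block_idx n t' b)"
      unfolding A1 .
  qed (use M D L H E A in auto)
  then have "eval_mat (?M * ?D + ?L * ?H) c = eval_mat (?E 1 * A) c" by simp
  moreover have "eval_mat (?E 1) c = ?E 1"
    unfolding eval_scalar_blocks by (rule block_mat_cong) auto
  ultimately have id: "eval_mat ?M c * eval_mat ?D c + eval_mat ?L c * eval_mat ?H c = ?E 1 * eval_mat A c"
    using eval_mat_add [OF mult_carrier_mat [OF M D] mult_carrier_mat [OF L H], of c]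
      eval_mat_mult [OF M D, of c] eval_mat_mult [OF L H, of c] eval_mat_mult [OF E(1) A, of c]
    by simp
  have KD: "eval_mat ?K c * eval_mat ?D c = 0\<^sub>m (l * n) n"
    using eval_mat_mult [OF K D, of c] by (simp add: K_cheb_mult_D_cheb)
  have iff: "z \<in> carrier_vec ((l + 1) * n + m * n) \<and> z \<noteq> 0\<^sub>v ((l + 1) * n + m * n) \<and>
      four_block_mat (eval_mat ?M c) (eval_mat ?L c) (eval_mat ?K c) (0\<^sub>m (l * n) (m * n)) *\<^sub>v z =
        0\<^sub>v ((m + 1) * n + l * n) \<longleftrightarrow>
    (\<exists>x. x \<in> carrier_vec n \<and> x \<noteq> 0\<^sub>v n \<and> eval_mat A c *\<^sub>v x = 0\<^sub>v n \<and>
      z = (eval_mat ?D c @\<^sub>r eval_mat ?H c) *\<^sub>v x)"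
    by (rule block_pencil_kernel [OF _ _ _ _ _ E(2) _ _ KD _ id])
      (use M L K D H A K_cheb_kernel D_cheb_injective K_cheb_transpose_injective in \<open>simp_all only: eval_mat_carrier\<close>)
  have ev: "eval_mat (four_block_mat ?M ?L ?K (0\<^sub>m (l * n) (m * n))) c =
      four_block_mat (eval_mat ?M c) (eval_mat ?L c) (eval_mat ?K c) (0\<^sub>m (l * n) (m * n))"
    using eval_four_block_mat [OF M L K zero_carrier_mat, of c] by simp
  have ap: "eval_mat (?D @\<^sub>r ?H) c = eval_mat ?D c @\<^sub>r eval_mat ?H c"
    by (rule eval_append_rows [OF D H])
  have dims: "dim_row A = n" "dim_col A = n"
    "dim_row (four_block_mat ?M ?L ?K (0\<^sub>m (l * n) (m * n))) = (m + 1) * n + l * n"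
    "dim_col (four_block_mat ?M ?L ?K (0\<^sub>m (l * n) (m * n))) = (l + 1) * n + m * n"
    using A M by auto
  show ?thesis
    unfolding right_eigenvector_def dims ev ap iff by blast
qed

section \<open>The pencil\<close>

lemma left_eigenvector_iff_transpose:
  "left_eigenvector A c y \<longleftrightarrow> right_eigenvector (transpose_mat A) c y"
proof -
  have "mat_of_row y * eval_mat A c = 0\<^sub>m 1 (dim_col A) \<longleftrightarrow>
      eval_mat (transpose_mat A) c *\<^sub>v y = 0\<^sub>v (dim_col A)"
    if y: "y \<in> carrier_vec (dim_row A)"
  proof -
    have e: "(mat_of_row y * eval_mat A c) $$ (0, j) = (eval_mat (transpose_mat A) c *\<^sub>v y) $ j"
      if "j < dim_col A" for j
    proof -
      have "y \<bullet> col (eval_mat A c) j = col (eval_mat A c) j \<bullet> y"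
        by (rule comm_scalar_prod [OF y], rule carrier_vecI) simp
      then show ?thesis unfolding eval_transpose using that by simp
    qed
    show ?thesis
    proof
      assume l: "mat_of_row y * eval_mat A c = 0\<^sub>m 1 (dim_col A)"
      show "eval_mat (transpose_mat A) c *\<^sub>v y = 0\<^sub>v (dim_col A)"
      proof (rule eq_vecI)
        fix j assume "j < dim_vec (0\<^sub>v (dim_col A) :: complex vec)"
        then have "j < dim_col A" by simp
        then show "(eval_mat (transpose_mat A) c *\<^sub>v y) $ j = 0\<^sub>v (dim_col A) $ j"
          using e [of j] unfolding l by simp
      qed simp
    next
      assume r: "eval_mat (transpose_mat A) c *\<^sub>v y = 0\<^sub>v (dim_col A)"
      show "mat_of_row y * eval_mat A c = 0\<^sub>m 1 (dim_col A)"
      proof (rule eq_matI)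
        fix i j assume "i < dim_row (0\<^sub>m 1 (dim_col A) :: complex mat)"
          "j < dim_col (0\<^sub>m 1 (dim_col A) :: complex mat)"
        then have "i = 0" "j < dim_col A" by simp_all
        then show "(mat_of_row y * eval_mat A c) $$ (i, j) = 0\<^sub>m 1 (dim_col A) $$ (i, j)"
          using e [of j] unfolding r by simp
      qed simp_all
    qed
  qed
  then show ?thesis
    unfolding left_eigenvector_def right_eigenvector_def by auto
qed

text \<open>Puts the extreme cases, \<epsilon> = k - 1 for H and \<epsilon> = 0 for G, into the
  generic stacked form with an empty lower part.\<close>

lemma append_no_rows: "B \<in> carrier_mat 0 (dim_col A) \<Longrightarrow> A @\<^sub>r B = A"
  unfolding append_rows_def by (rule eq_matI) auto

lemma transpose_append_cols:
  assumes "A \<in> carrier_mat nr nc1" "B \<in> carrier_mat nr nc2"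
  shows "transpose_mat (A @\<^sub>c B) = transpose_mat A @\<^sub>r transpose_mat B"
  unfolding append_cols_def append_rows_def by (rule eq_matI) (use assms in auto)

section \<open>Blocks of the pencil, H and G in terms of the scalar formulas\<close>

context
  fixes n k :: nat and P :: "nat \<Rightarrow> complex mat"
  assumes k: "2 \<le> k" and P: "\<And>i. i \<le> k \<Longrightarrow> P i \<in> carrier_mat n n"
begin

abbreviation entry_coeffs :: "nat \<times> nat \<Rightarrow> nat \<Rightarrow> complex poly" where
  "entry_coeffs ab \<equiv> \<lambda>i. [:P i $$ ab:]"

lemma P_dim [simp]: "i \<le> k \<Longrightarrow> dim_row (P i) = n" "i \<le> k \<Longrightarrow> dim_col (P i) = n"
  using P [of i] by auto

lemma cheb_mat_poly_eq:
  "cheb_mat_poly r n k P = mat n n (\<lambda>ab. \<Sum>i = 0..k. cheb r i * entry_coeffs ab i)"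
  unfolding cheb_mat_poly_def mat_sum_def
  by (rule eq_matI) auto

lemma cheb_horner_index:
  assumes "i \<le> k" "a < n" "b < n"
  shows "cheb_horner n k P e s i $$ (a, b) = horner k s (entry_coeffs (a, b)) e i"
  using assms unfolding cheb_horner_def mat_sum_def horner_def by simp

lemma cheb_horner_dim [simp]:
  "dim_row (cheb_horner n k P e s i) = n" "dim_col (cheb_horner n k P e s i) = n"
  by (simp_all add: cheb_horner_def mat_sum_def)

lemma M_cheb_eq:
  assumes "\<epsilon> \<le> k - 1" "\<epsilon> = 0 \<longrightarrow> r \<noteq> 1"
  shows "M_cheb r n k \<epsilon> P = block_mat n (k - \<epsilon>) (\<epsilon> + 1)
    (\<lambda>t s. mat n n (\<lambda>ab. M_coeff k \<epsilon> (entry_coeffs ab) t s))"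
proof -
  consider "\<epsilon> = k - 1" | "0 < \<epsilon>" "\<epsilon> < k - 1" | "\<epsilon> = 0" using assms by linarith
  then show ?thesis
  proof cases
    case 1
    \<comment> \<open>The only row is also the last one, so the generic last-row entries reproduce
      the whole block row.\<close>
    then have "k - \<epsilon> = 1" "\<epsilon> + 1 = k" using k by auto
    then show ?thesis
      unfolding M_cheb_def Let_def using 1 k
      by (simp del: One_nat_def)
        (rule block_mat_cong, auto simp: M_coeff_def lead_coeffs_def numeral_2_eq_2)
  next
    case 2
    then show ?thesis
      unfolding M_cheb_def Let_def
      by (simp del: One_nat_def) (rule block_mat_cong, auto simp: M_coeff_def lead_coeffs_def)
  next
    case 3
    then show ?thesis
      unfolding M_cheb_def Let_def using k assms
      by (simp del: One_nat_def) (rule block_mat_cong, auto simp: M_coeff_def lead_coeffs_def)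
  qed
qed

text \<open>For k = 2 the exceptional rows 2 and k are the same; \<open>M0_coeff\<close> tests the
  two conditions independently, which also covers this branch.\<close>

lemma M_cheb_0_1_eq:
  "M_cheb 1 n k 0 P = block_col n k (\<lambda>t. mat n n (\<lambda>ab. M0_coeff k (entry_coeffs ab) t))"
proof -
  have step: "[:1/2:] \<cdot>\<^sub>m block_col n k B = block_col n k (\<lambda>t. mat n n (\<lambda>ab. M0_coeff k (entry_coeffs ab) t))"
    if "\<And>t a b. t \<in> {1..k} \<Longrightarrow> a < n \<Longrightarrow> b < n \<Longrightarrow> [:1/2:] * B t $$ (a, b) = M0_coeff k (entry_coeffs (a, b)) t" for B
  proof (rule block_mat_eqI [where n = n and p = k and q = 1])
    fix s t a b assume *: "s \<in> {1..k}" "t \<in> {1..1::nat}" "a < n" "b < n"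
    show "([:1/2:] \<cdot>\<^sub>m block_col n k B) $$ (block_idx n s a, block_idx n t b) =
      block_col n k (\<lambda>t. mat n n (\<lambda>ab. M0_coeff k (entry_coeffs ab) t)) $$
        (block_idx n s a, block_idx n t b)"
      using * block_idx_less [OF *(1,3)] block_idx_less [OF *(2,4)] that [OF *(1,3,4)]
      by (simp only: index_smult_mat block_mat_carrier block_mat_index index_mat prod.case)
  qed (rule carrier_matI; simp)+
  show ?thesis
    unfolding M_cheb_def Let_def using k
    by (simp del: One_nat_def) (rule step, auto simp: M0_coeff_def numeral_poly Suc_diff_le numeral_2_eq_2)
qed

text \<open>The identity block that opens H for \<epsilon> = 0 and G for \<epsilon> = k - 1 is
  thereby an instance of D.\<close>

lemma D_cheb_0: "D_cheb n 0 s = 1\<^sub>m n"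
  unfolding D_cheb_def block_mat_def by (rule eq_matI) auto

lemma H_cheb_eq:
  assumes "\<epsilon> \<le> k - 1" "r \<in> {1, 2}" "\<epsilon> = 0 \<longrightarrow> r \<noteq> 1"
  shows "H_cheb r n k \<epsilon> P = D_cheb n \<epsilon> r @\<^sub>r block_col n (k - 1 - \<epsilon>)
    (\<lambda>i. mat n n (\<lambda>ab. - horner k r (entry_coeffs ab) \<epsilon> i))"
proof -
  have "block_col n (k - 1 - \<epsilon>) (\<lambda>i. mat n n (\<lambda>ab. - horner k r (entry_coeffs ab) \<epsilon> i)) =
    block_col n (k - 1 - \<epsilon>) (\<lambda>i. - cheb_horner n k P \<epsilon> r i)"
    by (rule block_mat_cong) (auto simp: cheb_horner_index)
  moreover have "D_cheb n \<epsilon> r @\<^sub>r block_col n 0 B = D_cheb n \<epsilon> r" for B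
    by (rule append_no_rows, rule carrier_matI) (simp_all add: D_cheb_def)
  ultimately show ?thesis
    unfolding H_cheb_def using assms k by (auto simp: D_cheb_0)
qed

lemma H_cheb_0_1_eq:
  "H_cheb 1 n k 0 P = D_cheb n 0 1 @\<^sub>r block_col n (k - 1)
    (\<lambda>i. mat n n (\<lambda>ab. - horner k 1 (entry_coeffs ab) 0 i + [:1/2:] * entry_coeffs ab (k - i)))"
proof -
  have "block_col n (k - 1)
      (\<lambda>i. mat n n (\<lambda>ab. - horner k 1 (entry_coeffs ab) 0 i + [:1/2:] * entry_coeffs ab (k - i))) =
    block_col n (k - 1) (\<lambda>i. - cheb_horner n k P 0 1 i + [:1/2:] \<cdot>\<^sub>m const_mat (P (k - i)))"
    by (rule block_mat_cong) (auto simp: cheb_horner_index)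
  then show ?thesis
    unfolding H_cheb_def using k by (simp add: D_cheb_0)
qed

lemma transpose_G_cheb_eq:
  assumes "\<epsilon> \<le> k - 1"
  shows "transpose_mat (G_cheb n k \<epsilon> P) = D_cheb n (k - 1 - \<epsilon>) 2 @\<^sub>r block_col n \<epsilon>
    (\<lambda>i. transpose_mat (mat n n (\<lambda>ab. - horner k 2 (entry_coeffs ab) 0 (k - \<epsilon> - 1 + i))))"
proof -
  have row: "transpose_mat (block_row n \<epsilon> (\<lambda>i. - cheb_horner n k P 0 2 (k - \<epsilon> - 1 + i))) =
    block_col n \<epsilon> (\<lambda>i. transpose_mat (mat n n (\<lambda>ab. - horner k 2 (entry_coeffs ab) 0 (k - \<epsilon> - 1 + i))))"
    (is "transpose_mat ?B = ?C")
    using assms k by (subst transpose_block_mat)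
      (auto intro!: block_mat_cong carrier_matI simp: cheb_horner_index)
  have D: "D_cheb n m 2 \<in> carrier_mat ((m + 1) * n) n" for m
    by (rule carrier_matI) (simp_all add: D_cheb_def)
  have B: "?B \<in> carrier_mat n (\<epsilon> * n)"
    by (rule carrier_matI) simp_all
  have append: "transpose_mat (transpose_mat (D_cheb n m 2) @\<^sub>c ?B) = D_cheb n m 2 @\<^sub>r ?C" for m
    using transpose_append_cols [of "transpose_mat (D_cheb n m 2)" n "(m + 1) * n" ?B] D [of m] B row by simp
  consider "\<epsilon> = k - 1" | "0 < \<epsilon>" "\<epsilon> < k - 1" | "\<epsilon> = 0" using assms by linarith
  then show ?thesis
  proof cases
    case 1
    then have "G_cheb n k \<epsilon> P = transpose_mat (D_cheb n 0 2) @\<^sub>c ?B"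
      unfolding G_cheb_def D_cheb_0 by simp
    then show ?thesis using append [of 0] 1 by simp
  next
    case 2
    then show ?thesis using append [of "k - 1 - \<epsilon>"] by (simp add: G_cheb_def)
  next
    case 3
    have "D_cheb n (k - 1) 2 @\<^sub>r block_col n 0 B = D_cheb n (k - 1) 2" for B
      by (rule append_no_rows, rule carrier_matI) (simp_all add: D_cheb_def)
    then show ?thesis unfolding 3 using k by (simp add: G_cheb_def)
  qed
qed

section \<open>Right and left eigenvectors of the pencil\<close>

lemma C_cheb_right_eigenvector:
  assumes r: "r \<in> {1, 2}" and \<epsilon>: "\<epsilon> \<le> k - 1"
  shows "right_eigenvector (C_cheb r n k \<epsilon> P) c z \<longleftrightarrow>
    (\<exists>x. right_eigenvector (cheb_mat_poly r n k P) c x \<and> z = eval_mat (H_cheb r n k \<epsilon> P) c *\<^sub>v x)"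
proof (cases "\<epsilon> = 0 \<and> r = 1")
  case False
  then have \<epsilon>0: "\<epsilon> = 0 \<longrightarrow> r \<noteq> 1" by blast
  have k\<epsilon>: "k - \<epsilon> = k - 1 - \<epsilon> + 1" using \<epsilon> k by simp
  show ?thesis
    unfolding C_cheb_def M_cheb_eq [OF \<epsilon> \<epsilon>0] H_cheb_eq [OF \<epsilon> r \<epsilon>0] cheb_mat_poly_eq k\<epsilon>
  proof (rule cheb_pencil_eigenvector)
    fix t a b assume *: "t \<in> {1..k - 1 - \<epsilon> + 1}" "a < n" "b < n"
    then have "1 \<le> t" "t \<le> k - \<epsilon>" using k\<epsilon> by auto
    from M_coeff_right [OF k \<epsilon> \<epsilon>0 this, of "entry_coeffs (a, b)"]
    show "(\<Sum>u = 1..\<epsilon> + 1. mat n n (\<lambda>ab. M_coeff k \<epsilon> (entry_coeffs ab) t u) $$ (a, b) * cheb r (\<epsilon> + 1 - u))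
      + (\<Sum>i = 1..k - 1 - \<epsilon>. K_coeff (k - 1 - \<epsilon>) two_X (cheb 2 1) i t
          * mat n n (\<lambda>ab. - horner k r (entry_coeffs ab) \<epsilon> i) $$ (a, b))
      = (if t = k - 1 - \<epsilon> + 1
         then mat n n (\<lambda>ab. \<Sum>i = 0..k. cheb r i * entry_coeffs ab i) $$ (a, b) else 0)"
      unfolding k\<epsilon> using *(2,3) by (simp only: index_mat prod.case)
  qed simp_all
next
  case True
  have k1: "k - 1 - 0 = k - 1" "k = k - 1 + 1" using k by simp_all
  have M: "M_cheb 1 n k 0 P = block_mat n (k - 1 + 1) (0 + 1)
      (\<lambda>t s. mat n n (\<lambda>ab. M0_coeff k (entry_coeffs ab) t))"
    using M_cheb_0_1_eq k1(2) by simp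
  have "right_eigenvector (C_cheb 1 n k 0 P) c z \<longleftrightarrow>
    (\<exists>x. right_eigenvector (cheb_mat_poly 1 n k P) c x \<and> z = eval_mat (H_cheb 1 n k 0 P) c *\<^sub>v x)"
    unfolding C_cheb_def M H_cheb_0_1_eq cheb_mat_poly_eq k1(1)
  proof (rule cheb_pencil_eigenvector)
    fix t a b assume *: "t \<in> {1..k - 1 + 1}" "a < n" "b < n"
    then have "1 \<le> t" "t \<le> k" using k by auto
    from M0_coeff_right [OF k this, of "entry_coeffs (a, b)"]
    show "(\<Sum>u = 1..0 + 1. mat n n (\<lambda>ab. M0_coeff k (entry_coeffs ab) t) $$ (a, b) * cheb 1 (0 + 1 - u))
      + (\<Sum>i = 1..k - 1. K_coeff (k - 1) two_X (cheb 2 1) i t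
          * mat n n (\<lambda>ab. - horner k 1 (entry_coeffs ab) 0 i + [:1/2:] * entry_coeffs ab (k - i)) $$ (a, b))
      = (if t = k - 1 + 1
         then mat n n (\<lambda>ab. \<Sum>i = 0..k. cheb 1 i * entry_coeffs ab i) $$ (a, b) else 0)"
      unfolding k1(2) [symmetric] using *(2,3) by (simp del: cheb.simps(2,3))
  qed simp_all
  then show ?thesis using True by simp
qed

lemma C_cheb_left_eigenvector:
  assumes r: "r \<in> {1, 2}" and \<epsilon>: "\<epsilon> \<le> k - 1"
  shows "left_eigenvector (C_cheb r n k \<epsilon> P) c w \<longleftrightarrow>
    (\<exists>y. left_eigenvector (cheb_mat_poly r n k P) c y \<and>
      w = transpose_mat (eval_mat (G_cheb n k \<epsilon> P) c) *\<^sub>v y)"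
proof -
  have k\<epsilon>: "k - \<epsilon> = k - 1 - \<epsilon> + 1" using \<epsilon> k by simp
  define \<mu> where "\<mu> t s = mat n n (\<lambda>ab. if \<epsilon> = 0 \<and> r = 1
      then M0_coeff k (entry_coeffs ab) t else M_coeff k \<epsilon> (entry_coeffs ab) t s)" for t s
  have M: "M_cheb r n k \<epsilon> P = block_mat n (k - 1 - \<epsilon> + 1) (\<epsilon> + 1) \<mu>"
  proof (cases "\<epsilon> = 0 \<and> r = 1")
    case True
    then show ?thesis using M_cheb_0_1_eq k\<epsilon> unfolding \<mu>_def by simp
  next
    case False
    have "\<mu> = (\<lambda>t s. mat n n (\<lambda>ab. M_coeff k \<epsilon> (entry_coeffs ab) t s))"
      by (intro ext) (simp only: \<mu>_def False if_False)
    then show ?thesis using M_cheb_eq [OF \<epsilon>, of r] False k\<epsilon> by auto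
  qed
  have K: "K_cheb n m s \<in> carrier_mat (m * n) ((m + 1) * n)" for m s
    by (rule carrier_matI) (simp_all add: K_cheb_eq)
  \<comment> \<open>Transposition exchanges \<open>K_1\<close> and \<open>K_2\<close>, hence the
    kinds r and 2 and the sizes \<epsilon> and k - 1 - \<epsilon>.\<close>
  have C: "transpose_mat (C_cheb r n k \<epsilon> P) =
    four_block_mat (block_mat n (\<epsilon> + 1) (k - 1 - \<epsilon> + 1) (\<lambda>s t. transpose_mat (\<mu> t s)))
      (transpose_mat (K_cheb n \<epsilon> r)) (K_cheb n (k - 1 - \<epsilon>) 2) (0\<^sub>m ((k - 1 - \<epsilon>) * n) (\<epsilon> * n))"
    unfolding C_cheb_def M
    by (subst transpose_four_block_mat [OF block_mat_carrier(1) transpose_carrier_mat [THEN iffD2, OF K] K zero_carrier_mat])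
      (subst transpose_block_mat, simp_all add: \<mu>_def)
  have eq: "(\<Sum>u = 1..k - 1 - \<epsilon> + 1. transpose_mat (\<mu> u t) $$ (a, b) * cheb 2 (k - 1 - \<epsilon> + 1 - u))
      + (\<Sum>i = 1..\<epsilon>. K_coeff \<epsilon> two_X (cheb r 1) i t
          * transpose_mat (mat n n (\<lambda>ab. - horner k 2 (entry_coeffs ab) 0 (k - \<epsilon> - 1 + i))) $$ (a, b))
      = (if t = \<epsilon> + 1
         then transpose_mat (mat n n (\<lambda>ab. \<Sum>i = 0..k. cheb r i * entry_coeffs ab i)) $$ (a, b) else 0)"
    if t: "t \<in> {1..\<epsilon> + 1}" and ab: "a < n" "b < n" for t a b
  proof (cases "\<epsilon> = 0 \<and> r = 1")
    case True
    then show ?thesis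
      using M0_coeff_left [OF k, of "entry_coeffs (b, a)"] ab t unfolding \<mu>_def k\<epsilon> [symmetric]
      by (simp del: cheb.simps(2,3))
  next
    case False
    then have \<epsilon>0: "\<epsilon> = 0 \<longrightarrow> r \<noteq> 1" by blast
    have "1 \<le> t" "t \<le> \<epsilon> + 1" using t by auto
    \<comment> \<open>Position \<open>(a, b)\<close> of a transposed block is position
      \<open>(b, a)\<close> of the coefficients.\<close>
    from M_coeff_left [OF k \<epsilon> r \<epsilon>0 this, of "entry_coeffs (b, a)"] show ?thesis
      unfolding \<mu>_def k\<epsilon> [symmetric] using ab False
      by (simp only: index_transpose_mat index_mat prod.case dim_row_mat dim_col_mat if_False)
  qed
  show ?thesis
    unfolding left_eigenvector_iff_transpose C cheb_mat_poly_eq eval_transpose [symmetric]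
      transpose_G_cheb_eq [OF \<epsilon>]
    by (rule cheb_pencil_eigenvector [OF _ _ _ eq]) (simp_all add: \<mu>_def)
qed

end

theorem theorem5p12:
  fixes r n k \<epsilon> :: nat
    and P :: "nat \<Rightarrow> complex mat"
    and lambda0 :: complex
    and z w :: "complex vec"
  assumes "k \<ge> 2"
    and "r \<in> {1, 2}"
    and "\<And>i. i \<le> k \<Longrightarrow> P i \<in> carrier_mat n n"
    and "regular_mat_poly (cheb_mat_poly r n k P)"
    and "finite_eigenvalue (cheb_mat_poly r n k P) lambda0"
    and "\<epsilon> \<le> k - 1"
  shows "(right_eigenvector (C_cheb r n k \<epsilon> P) lambda0 z \<longleftrightarrow>
           (\<exists>x. right_eigenvector (cheb_mat_poly r n k P) lambda0 x \<and>
                z = eval_mat (H_cheb r n k \<epsilon> P) lambda0 *\<^sub>v x))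
       \<and> (left_eigenvector (C_cheb r n k \<epsilon> P) lambda0 w \<longleftrightarrow>
           (\<exists>y. left_eigenvector (cheb_mat_poly r n k P) lambda0 y \<and>
                w = transpose_mat (eval_mat (G_cheb n k \<epsilon> P) lambda0) *\<^sub>v y))"
  using C_cheb_right_eigenvector [where P = P, OF assms(1,3,2,6)]
    C_cheb_left_eigenvector [where P = P, OF assms(1,3,2,6)]
  by blast

end
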